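(* There is a universal constant $C>0$ such that for every integer $n\ge 1$, every function $f\colon\{0,1\}^n\to\{0,1\}$, every $0$-biased product distribution $\mu$ over $\{0,1\}^n$, every $\gamma\in(0,1/n)$ and every $\epsilon\ge 0$, $$\overline{\mathsf{D}}_{\epsilon+\gamma}(f,\mu)\;\le\; C\cdot\log(n/\gamma)\cdot\big(\mathsf{S}_\epsilon(f,\mu)+1\big).$$
   Context: Inner products are over $\mathbb{F}_2$: $\langle a,x\rangle=\sum_i a_ix_i \bmod 2$. A deterministic parity decision tree $T$ on $\{0,1\}^n$ is a rooted binary tree in which every internal node is labelled by a vector $a\in\{0,1\}^n$ (the query $\langle a,x\rangle$) and has two children, one for each outcome in $\{0,1\}$, and every leaf is labelled by an output bit; $T(x)$ is the label of the leaf reached on input $x$, and $q(T,x)$ is the number of queries made by $T$ on $x$. A randomised parity decision tree $\mathcal{T}$ is a probability distribution over deterministic ones. For a distribution $\nu$ on $\{0,1\}^n$, $\overline{q}(\mathcal{T},\nu)=\mathbb{E}_{T\sim\mathcal{T},x\sim\nu}[q(T,x)]$, $\mathrm{err}_f(\mathcal{T},\nu)=\Pr_{T\sim\mathcal{T},x\sim\nu}[T(x)\ne f(x)]$, and $\overline{\mathsf{D}}_\epsilon(f,\nu)=\min_{\mathcal{T}}\{\overline{q}(\mathcal{T},\nu):\mathrm{err}_f(\mathcal{T},\nu)\le\epsilon\}$. A product distribution $\mu$ on $\{0,1\}^n$ (a product of $n$ independent Bernoulli distributions) is $0$-biased if $\Pr_{x\sim\mu}[x_i=0]\ge 1/2$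 for every $i$. For such $\mu$ put $\delta_i=2\Pr_{x\sim\mu}[x_i=1]\in[0,1]$. The random partial fixing $\mathcal{R}_\mu$ is the distribution of $\rho\in\{0,\star\}^n$ with independent coordinates, $\rho_i=0$ with probability $1-\delta_i$ and $\rho_i=\star$ with probability $\delta_i$. $\mathcal{U}_\rho$ is the uniform distribution on $\{x\in\{0,1\}^n: x_i=0 \text{ whenever }\rho_i=0\}$. For a deterministic tree $T$ and $\rho\in\{0,\star\}^n$, $T_\rho$ is the tree obtained from $T$ by fixing $x_i=0$ for all $i$ with $\rho_i=0$ (so each query is restricted to the coordinates with $\rho_i=\star$) and then removing redundant queries, i.e. those whose restricted query vector is an $\mathbb{F}_2$-linear combination of the restricted query vectors made earlier on the path (their answers are determined by the earlier ones). For randomised $\mathcal{T}$, $\mathcal{T}_\rho$ is the distribution of $T_\rho$ with $T\sim\mathcal{T}$. Skew average cost: $\overline{sq}(\mathcal{T},\mu)=\mathbb{E}_{\rho\sim\mathcal{R}_\mu}[\overline{q}(\mathcal{T}_\rho,\mathcal{U}_\rho)]$. Skew measure: $\mathsf{S}_\epsilon(f,\mu)=\min_{\mathcal{T}}\{\overline{sq}(\mathcal{T},\mu):\mathrm{err}_f(\mathcal{T},\mu)\le\epsilon\}$, the minimum over randomised parity decision trees. *)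

theory Defs
  imports "HOL-Probability.Probability" "HOL-Probability.Product_PMF" "HOL-Library.Z2"
begin

(* Vectors of dimension n are functions nat => bit that vanish outside {..<n}; the field bit of
   HOL-Library.Z2 is used as F_2, so that + and * below are taken modulo 2. *)
definition cube :: "nat \<Rightarrow> (nat \<Rightarrow> bit) set" where
  "cube n = {x. \<forall>i\<ge>n. x i = 0}"

definition ip :: "nat \<Rightarrow> (nat \<Rightarrow> bit) \<Rightarrow> (nat \<Rightarrow> bit) \<Rightarrow> bit" where
  "ip n a x = (\<Sum>i<n. a i * x i)"

(* In Query a T0 T1, the subtree Tb is the child for the outcome b of the query a. *)
datatype pdt = Leaf bit | Query "nat \<Rightarrow> bit" pdt pdt

primrec pdt_on :: "nat \<Rightarrow> pdt \<Rightarrow> bool" where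
  "pdt_on n (Leaf b) \<longleftrightarrow> True"
| "pdt_on n (Query a T0 T1) \<longleftrightarrow> a \<in> cube n \<and> pdt_on n T0 \<and> pdt_on n T1"

primrec pdt_eval :: "nat \<Rightarrow> pdt \<Rightarrow> (nat \<Rightarrow> bit) \<Rightarrow> bit" where
  "pdt_eval n (Leaf b) x = b"
| "pdt_eval n (Query a T0 T1) x = (if ip n a x = 0 then pdt_eval n T0 x else pdt_eval n T1 x)"

primrec num_queries :: "nat \<Rightarrow> pdt \<Rightarrow> (nat \<Rightarrow> bit) \<Rightarrow> nat" where
  "num_queries n (Leaf b) x = 0"
| "num_queries n (Query a T0 T1) x =
     Suc (if ip n a x = 0 then num_queries n T0 x else num_queries n T1 x)"

(* There are only countably many trees on the n-cube, so every probability distribution over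
   them is a pmf. *)
definition rpdt_on :: "nat \<Rightarrow> pdt pmf \<Rightarrow> bool" where
  "rpdt_on n \<T> \<longleftrightarrow> (\<forall>T\<in>set_pmf \<T>. pdt_on n T)"

(* Costs are valued in ennreal: a randomised tree may have unbounded depth and hence infinite
   expected cost, which the Bochner integral would turn into 0. *)
definition avg_queries :: "nat \<Rightarrow> pdt pmf \<Rightarrow> (nat \<Rightarrow> bit) pmf \<Rightarrow> ennreal" where
  "avg_queries n \<T> \<nu> =
     (\<integral>\<^sup>+ (T, x). of_nat (num_queries n T x) \<partial>measure_pmf (pair_pmf \<T> \<nu>))"

definition err ::
  "nat \<Rightarrow> ((nat \<Rightarrow> bit) \<Rightarrow> bit) \<Rightarrow> pdt pmf \<Rightarrow> (nat \<Rightarrow> bit) pmf \<Rightarrow> real" where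
  "err n f \<T> \<nu> = measure_pmf.prob (pair_pmf \<T> \<nu>) {(T, x). pdt_eval n T x \<noteq> f x}"

(* The infimum is a minimum: redundant queries can be dropped, and only finitely many trees on the
   n-cube have no redundant query. *)
definition avg_complexity ::
  "nat \<Rightarrow> real \<Rightarrow> ((nat \<Rightarrow> bit) \<Rightarrow> bit) \<Rightarrow> (nat \<Rightarrow> bit) pmf \<Rightarrow> ennreal" where
  "avg_complexity n \<epsilon> f \<nu> =
     (INF \<T>\<in>{\<T>. rpdt_on n \<T> \<and> err n f \<T> \<nu> \<le> \<epsilon>}. avg_queries n \<T> \<nu>)"

definition product_distribution :: "nat \<Rightarrow> (nat \<Rightarrow> bit) pmf \<Rightarrow> bool" where
  "product_distribution n \<mu> \<longleftrightarrow>
     (\<exists>p. (\<forall>i<n. 0 \<le> p i \<and> p i \<le> 1) \<and>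
          \<mu> = Pi_pmf {..<n} 0 (\<lambda>i. map_pmf of_bool (bernoulli_pmf (p i))))"

definition zero_biased :: "nat \<Rightarrow> (nat \<Rightarrow> bit) pmf \<Rightarrow> bool" where
  "zero_biased n \<mu> \<longleftrightarrow> product_distribution n \<mu> \<and>
     (\<forall>i<n. measure_pmf.prob \<mu> {x. x i = 0} \<ge> 1 / 2)"

datatype mark = Zero | Star

definition delta :: "(nat \<Rightarrow> bit) pmf \<Rightarrow> nat \<Rightarrow> real" where
  "delta \<mu> i = 2 * measure_pmf.prob \<mu> {x. x i = 1}"

definition random_fixing :: "nat \<Rightarrow> (nat \<Rightarrow> bit) pmf \<Rightarrow> (nat \<Rightarrow> mark) pmf" where
  "random_fixing n \<mu> =
     Pi_pmf {..<n} Zero (\<lambda>i. map_pmf (\<lambda>b. if b then Star else Zero) (bernoulli_pmf (delta \<mu> i)))"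

definition uniform_fixed :: "nat \<Rightarrow> (nat \<Rightarrow> mark) \<Rightarrow> (nat \<Rightarrow> bit) pmf" where
  "uniform_fixed n \<rho> = pmf_of_set {x \<in> cube n. \<forall>i<n. \<rho> i = Zero \<longrightarrow> x i = 0}"

primrec fix_zeros :: "(nat \<Rightarrow> mark) \<Rightarrow> pdt \<Rightarrow> pdt" where
  "fix_zeros \<rho> (Leaf b) = Leaf b"
| "fix_zeros \<rho> (Query a T0 T1) =
     Query (\<lambda>i. if \<rho> i = Star then a i else 0) (fix_zeros \<rho> T0) (fix_zeros \<rho> T1)"

(* ps lists earlier queries together with their answers; a is a linear combination of these
   queries, and b is the same linear combination of the answers. *)
definition determined :: "nat \<Rightarrow> ((nat \<Rightarrow> bit) \<times> bit) list \<Rightarrow> (nat \<Rightarrow> bit) \<Rightarrow> bit \<Rightarrow> bool" where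
  "determined n ps a b \<longleftrightarrow>
     (\<exists>c :: nat \<Rightarrow> bit. (\<forall>i<n. a i = (\<Sum>j<length ps. c j * fst (ps ! j) i)) \<and>
                     b = (\<Sum>j<length ps. c j * snd (ps ! j)))"

(* ps records only the queries kept so far. Their span contains the removed ones as well, and
   they are linearly independent, so at most one answer b is determined. *)
primrec prune :: "nat \<Rightarrow> ((nat \<Rightarrow> bit) \<times> bit) list \<Rightarrow> pdt \<Rightarrow> pdt" where
  "prune n ps (Leaf b) = Leaf b"
| "prune n ps (Query a T0 T1) =
     (if determined n ps a 0 then prune n ps T0
      else if determined n ps a 1 then prune n ps T1
      else Query a (prune n ((a, 0) # ps) T0) (prune n ((a, 1) # ps) T1))"

definition restrict_pdt :: "nat \<Rightarrow> (nat \<Rightarrow> mark) \<Rightarrow> pdt \<Rightarrow> pdt" where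
  "restrict_pdt n \<rho> T = prune n [] (fix_zeros \<rho> T)"

definition skew_cost :: "nat \<Rightarrow> pdt pmf \<Rightarrow> (nat \<Rightarrow> bit) pmf \<Rightarrow> ennreal" where
  "skew_cost n \<T> \<mu> =
     (\<integral>\<^sup>+ \<rho>. avg_queries n (map_pmf (restrict_pdt n \<rho>) \<T>) (uniform_fixed n \<rho>)
        \<partial>measure_pmf (random_fixing n \<mu>))"

definition skew_measure ::
  "nat \<Rightarrow> real \<Rightarrow> ((nat \<Rightarrow> bit) \<Rightarrow> bit) \<Rightarrow> (nat \<Rightarrow> bit) pmf \<Rightarrow> ennreal" where
  "skew_measure n \<epsilon> f \<mu> =
     (INF \<T>\<in>{\<T>. rpdt_on n \<T> \<and> err n f \<T> \<mu> \<le> \<epsilon>}. skew_cost n \<T> \<mu>)"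

end

theory Submission
  imports Defs
begin

text \<open>Sampling \<open>x\<close> from \<open>\<mu>\<close> and then marking every zero coordinate \<open>i\<close> independently with the
  conditional probability of a star produces the joint distribution of \<open>\<rho>\<close> and \<open>x\<close>. So it is
  enough to run \<open>T\<^sub>\<rho>\<close> on \<open>x\<close> for this \<open>\<rho>\<close>, whose stars are the marked coordinates, known to
  the algorithm, and the unknown coordinates with \<open>x\<^sub>i = 1\<close>. The algorithm pretends that the
  known stars are all stars, follows the path of \<open>T\<close> as long as every query is determined by
  the queries made so far, and collects the coordinates that have to vanish for this to be
  right. A noisy binary search with random parities finds the first of them that carries a 1, at
  the cost of \<open>O(log (n / \<gamma>))\<close> queries. The query of \<open>T\<close> responsible for this coordinate is
  not redundant in \<open>T\<^sub>\<rho>\<close>, so the search is paid for by one query of \<open>T\<^sub>\<rho>\<close>; only the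
  last search, which finds nothing, is not, whence the additional 1. There are at most \<open>n + 1\<close>
  searches, so an error probability of \<open>\<gamma> / (n + 1)\<close> is affordable for each of them, and since
  \<open>\<gamma> < 1 / n\<close> even the runs derailed by an error contribute little to the expected cost.\<close>

section \<open>Random parity tests\<close>

declare add_bit_eq_xor [simp del] mult_bit_eq_and [simp del]

lemma bit_add_eq_0_iff: "a + b = 0 \<longleftrightarrow> a = b" for a b :: bit
  by (cases a; cases b) auto

lemma ip_add: "ip n (\<lambda>i. a i + b i) x = ip n a x + ip n b x"
  by (simp add: ip_def distrib_right sum.distrib)

text \<open>Both subtrees are sampled, independently of each other. An input follows only one of
  them, so expectations along its path do not see their joint law.\<close>

definition query_pmf :: "(nat \<Rightarrow> bit) \<Rightarrow> pdt pmf \<Rightarrow> pdt pmf \<Rightarrow> pdt pmf" where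
  "query_pmf a P0 P1 = do {T0 \<leftarrow> P0; T1 \<leftarrow> P1; return_pmf (Query a T0 T1)}"

definition random_mask :: "nat set \<Rightarrow> (nat \<Rightarrow> bit) pmf" where
  "random_mask W = pmf_of_set (PiE_dflt W 0 (\<lambda>_. UNIV))"

definition zero_on :: "(nat \<Rightarrow> bit) \<Rightarrow> nat set \<Rightarrow> bool" where
  "zero_on x W \<longleftrightarrow> (\<forall>i\<in>W. x i = 0)"

definition test :: "nat set \<Rightarrow> pdt pmf \<Rightarrow> pdt pmf \<Rightarrow> pdt pmf" where
  "test W P0 P1 = do {m \<leftarrow> random_mask W; query_pmf m P0 P1}"

text \<open>Only the answer 1 is conclusive. A single test misses a 1 with probability 1/2, and a
  walk with that error rate has no drift; the repetition lowers it to 1/4.\<close>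

definition test_twice :: "nat set \<Rightarrow> pdt pmf \<Rightarrow> pdt pmf \<Rightarrow> pdt pmf" where
  "test_twice W P0 P1 = test W (test W P0 P1) P1"

lemma UNIV_bit: "(UNIV :: bit set) = {0, 1}"
  by (auto intro: bit.exhaust)

lemma finite_masks: "finite W \<Longrightarrow> finite (PiE_dflt W (0::bit) (\<lambda>_. UNIV))"
  by (auto simp: UNIV_bit)

lemma set_random_mask:
  "finite W \<Longrightarrow> set_pmf (random_mask W) = PiE_dflt W 0 (\<lambda>_. UNIV)"
  by (auto simp: random_mask_def finite_masks set_pmf_of_set)

lemma random_mask_zero:
  assumes "finite W" "zero_on x W" "m \<in> set_pmf (random_mask W)"
  shows "ip n m x = 0"
proof -
  have "m i * x i = 0" for i
    using assms by (cases "i \<in> W") (auto simp: set_random_mask PiE_dflt_def zero_on_def)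
  then show ?thesis unfolding ip_def by (intro sum.neutral) auto
qed

text \<open>Toggling the mask at a coordinate of \<open>W\<close> where \<open>x\<close> is 1
  preserves the uniform distribution and flips the parity, so both answers are equally
  likely.\<close>

lemma random_mask_coin:
  fixes g :: "bit \<Rightarrow> ennreal"
  assumes W: "finite W" "W \<subseteq> {..<n}" "\<not> zero_on x W"
  shows "(\<integral>\<^sup>+ m. g (ip n m x) \<partial>random_mask W) = ennreal (1/2) * (g 0 + g 1)"
proof -
  obtain p where p: "p \<in> W" "x p = 1" using W(3) by (auto simp: zero_on_def)
  define u :: "nat \<Rightarrow> bit" where "u = (\<lambda>i. of_bool (i = p))"
  let ?flip = "\<lambda>m i. m i + u i"
  let ?A = "PiE_dflt W (0::bit) (\<lambda>_. UNIV)"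
  let ?I = "\<integral>\<^sup>+ m. g (ip n m x) \<partial>random_mask W"
  have uu: "u i + u i = 0" for i by (simp add: bit_add_eq_0_iff)
  have ipu: "ip n u x = 1"
  proof -
    have "ip n u x = (\<Sum>i<n. if i = p then x i else 0)"
      unfolding ip_def u_def by (intro sum.cong) auto
    then show ?thesis using p W(2) by auto
  qed
  have "bij_betw ?flip ?A ?A"
    by (rule bij_betwI[of _ _ _ ?flip])
      (use p uu in \<open>auto simp: PiE_dflt_def u_def add.assoc\<close>)
  then have "map_pmf ?flip (random_mask W) = random_mask W"
    unfolding random_mask_def
    by (intro map_pmf_of_set_bij_betw) (use W finite_masks in auto)
  then have "?I = (\<integral>\<^sup>+ m. g (ip n m x) \<partial>map_pmf ?flip (random_mask W))" by simp
  also have "\<dots> = (\<integral>\<^sup>+ m. g (ip n m x + 1) \<partial>random_mask W)"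
    by (simp add: ip_add ipu)
  finally have "?I + ?I = (\<integral>\<^sup>+ m. g (ip n m x) + g (ip n m x + 1) \<partial>random_mask W)"
    by (simp add: nn_integral_add)
  also have "\<dots> = (\<integral>\<^sup>+ m. g 0 + g 1 \<partial>random_mask W)"
  proof (intro nn_integral_cong)
    fix m show "g (ip n m x) + g (ip n m x + 1) = g 0 + g 1"
      by (cases "ip n m x") (auto simp: add.commute)
  qed
  also have "\<dots> = g 0 + g 1" by simp
  finally have *: "?I + ?I = g 0 + g 1" .
  have "?I = ennreal (1/2 + 1/2) * ?I" by simp
  also have "\<dots> = ennreal (1/2) * (?I + ?I)"
    by (subst ennreal_plus) (auto simp: distrib_left distrib_right)
  finally show ?thesis using * by simp
qed

lemma PiE_dflt_cube: "W \<subseteq> {..<n} \<Longrightarrow> m \<in> PiE_dflt W 0 B \<Longrightarrow> m \<in> cube n"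
  by (force simp: PiE_dflt_def cube_def)

lemma rpdt_on_query_pmf:
  "a \<in> cube n \<Longrightarrow> rpdt_on n P0 \<Longrightarrow> rpdt_on n P1 \<Longrightarrow> rpdt_on n (query_pmf a P0 P1)"
  by (auto simp: rpdt_on_def query_pmf_def)

lemma rpdt_on_test:
  assumes "W \<subseteq> {..<n}" "rpdt_on n P0" "rpdt_on n P1"
  shows "rpdt_on n (test W P0 P1)"
proof -
  have "finite W" using assms(1) finite_subset by blast
  have "rpdt_on n (query_pmf m P0 P1)" if "m \<in> set_pmf (random_mask W)" for m
    using that assms \<open>finite W\<close>
    by (intro rpdt_on_query_pmf) (auto simp: set_random_mask PiE_dflt_cube)
  then show ?thesis by (auto simp: rpdt_on_def test_def)
qed

lemma rpdt_on_test_twice: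
  "W \<subseteq> {..<n} \<Longrightarrow> rpdt_on n P0 \<Longrightarrow> rpdt_on n P1 \<Longrightarrow> rpdt_on n (test_twice W P0 P1)"
  by (simp add: test_twice_def rpdt_on_test)

lemma half_add_half:
  fixes A a b :: ennreal
  shows "ennreal (1/2) * ((A + a) + (A + b)) = A + ennreal (1/2) * (a + b)"
proof -
  have "A = ennreal (1/2 + 1/2) * A" by simp
  also have "\<dots> = ennreal (1/2) * (A + A)"
    by (subst ennreal_plus) (auto simp: distrib_left distrib_right)
  finally have "A = ennreal (1/2) * (A + A)" .
  then show ?thesis by (metis (no_types, lifting) add.assoc add.left_commute distrib_left)
qed

text \<open>A functional that charges \<open>c\<close> for every query on the path of \<open>x\<close>, plus a charge
  at the leaf; it specialises to the number of queries and to the indicator of an error.\<close>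

locale path_cost =
  fixes n :: nat and x :: "nat \<Rightarrow> bit" and c :: real and \<phi> :: "pdt \<Rightarrow> ennreal"
  assumes c_nonneg: "0 \<le> c"
    and \<phi>_Query: "\<phi> (Query a T0 T1) = ennreal c + \<phi> (if ip n a x = 0 then T0 else T1)"
begin

definition \<Phi> :: "pdt pmf \<Rightarrow> ennreal" where
  "\<Phi> P = (\<integral>\<^sup>+ T. \<phi> T \<partial>P)"

lemma \<Phi>_bind: "\<Phi> (bind_pmf R P) = (\<integral>\<^sup>+ r. \<Phi> (P r) \<partial>R)"
  by (simp add: \<Phi>_def)

lemma \<Phi>_return [simp]: "\<Phi> (return_pmf T) = \<phi> T"
  by (simp add: \<Phi>_def)

lemma \<Phi>_query: "\<Phi> (query_pmf a P0 P1) = ennreal c + \<Phi> (if ip n a x = 0 then P0 else P1)"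
  by (simp add: \<Phi>_def query_pmf_def \<phi>_Query nn_integral_add)

lemma \<Phi>_test_zero:
  assumes "finite W" "zero_on x W"
  shows "\<Phi> (test W P0 P1) = ennreal c + \<Phi> P0"
proof -
  have "\<Phi> (test W P0 P1) = (\<integral>\<^sup>+ m. ennreal c + \<Phi> P0 \<partial>random_mask W)"
    unfolding test_def \<Phi>_bind \<Phi>_query
    by (intro nn_integral_cong_AE AE_pmfI) (use random_mask_zero assms in auto)
  then show ?thesis by simp
qed

lemma \<Phi>_test_nonzero:
  assumes "W \<subseteq> {..<n}" "\<not> zero_on x W"
  shows "\<Phi> (test W P0 P1) = ennreal c + ennreal (1/2) * (\<Phi> P0 + \<Phi> P1)"
proof -
  have "finite W" using assms(1) finite_subset by blast
  have "\<Phi> (test W P0 P1) =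
      (\<integral>\<^sup>+ m. ennreal c + (if ip n m x = 0 then \<Phi> P0 else \<Phi> P1) \<partial>random_mask W)"
    by (simp add: test_def \<Phi>_bind \<Phi>_query if_distrib)
  also have "\<dots> = ennreal c + (\<integral>\<^sup>+ m. (if ip n m x = 0 then \<Phi> P0 else \<Phi> P1) \<partial>random_mask W)"
    by (simp add: nn_integral_add)
  finally show ?thesis
    using random_mask_coin[of W n x "\<lambda>b. if b = 0 then \<Phi> P0 else \<Phi> P1"] assms \<open>finite W\<close> by simp
qed

text \<open>The bounds are split into \<open>A\<close>, the cost of the right continuation, which
  may be infinite, and a real excess \<open>e\<close>, so that the bookkeeping of queries and errors
  is real arithmetic.\<close>

lemma \<Phi>_test_twice_zero:
  assumes "W \<subseteq> {..<n}" "zero_on x W"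
    and "\<Phi> P0 \<le> A + ennreal e" "0 \<le> e"
  shows "\<Phi> (test_twice W P0 P1) \<le> A + ennreal (2 * c + e)"
proof -
  have "finite W" using assms(1) finite_subset by blast
  then have "\<Phi> (test_twice W P0 P1) = ennreal c + (ennreal c + \<Phi> P0)"
    using assms by (simp add: test_twice_def \<Phi>_test_zero)
  also have "\<dots> \<le> ennreal c + (ennreal c + (A + ennreal e))"
    using assms by (intro add_left_mono)
  also have "\<dots> = A + ennreal (2 * c + e)"
    using c_nonneg assms(4) by (simp add: ac_simps mult_2 flip: ennreal_plus)
  finally show ?thesis .
qed

lemma \<Phi>_test_nonzero_le:
  assumes "W \<subseteq> {..<n}" "\<not> zero_on x W"
    and "\<Phi> P0 \<le> A + ennreal e0" "\<Phi> P1 \<le> A + ennreal e1" "0 \<le> e0" "0 \<le> e1"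
  shows "\<Phi> (test W P0 P1) \<le> A + ennreal (c + (e0 + e1) / 2)"
proof -
  have "\<Phi> (test W P0 P1) \<le> ennreal c + ennreal (1/2) * ((A + ennreal e0) + (A + ennreal e1))"
    unfolding \<Phi>_test_nonzero[OF assms(1,2)]
    using assms by (intro add_left_mono mult_left_mono add_mono) auto
  also have "\<dots> = A + (ennreal c + ennreal (1/2) * ennreal (e0 + e1))"
    unfolding half_add_half using assms(5,6) by (simp add: ac_simps)
  also have "\<dots> = A + ennreal (c + (e0 + e1) / 2)"
    using c_nonneg assms(5,6) by (subst ennreal_mult[symmetric]) auto
  finally show ?thesis .
qed

lemma \<Phi>_test_twice_nonzero:
  assumes "W \<subseteq> {..<n}" "\<not> zero_on x W"
    and "\<Phi> P0 \<le> A + ennreal e0" "\<Phi> P1 \<le> A + ennreal e1" "0 \<le> e0" "0 \<le> e1"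
  shows "\<Phi> (test_twice W P0 P1) \<le> A + ennreal (2 * c + (e0 + 3 * e1) / 4)"
proof -
  have "\<Phi> (test_twice W P0 P1) \<le> A + ennreal (c + ((c + (e0 + e1) / 2) + e1) / 2)"
    unfolding test_twice_def using assms c_nonneg
    by (intro \<Phi>_test_nonzero_le) auto
  \<comment> \<open>The second query is made only half of the time, which gives
    \<open>3 / 2 * c\<close>; it is rounded up to match the other cases.\<close>
  also have "\<dots> \<le> A + ennreal (2 * c + (e0 + 3 * e1) / 4)"
    using c_nonneg by (intro add_left_mono ennreal_leI) (simp add: field_simps)
  finally show ?thesis .
qed

lemma \<Phi>_test_twice:
  assumes "W \<subseteq> {..<n}"
    and "\<Phi> P0 \<le> A + ennreal e" "\<Phi> P1 \<le> A + ennreal e" "0 \<le> e"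
  shows "\<Phi> (test_twice W P0 P1) \<le> A + ennreal (2 * c + e)"
  using \<Phi>_test_twice_zero[of W P0 A e P1] \<Phi>_test_twice_nonzero[of W P0 A e P1 e] assms
  by (cases "zero_on x W") auto

end

section \<open>Noisy binary search\<close>

text \<open>The state \<open>(l, j)\<close> stands for the dyadic interval from \<open>j * 2 ^ l\<close> to
  \<open>(j + 1) * 2 ^ l - 1\<close>. A test only errs by overlooking a 1, so the upper end of the interval
  is always certified; an error shows up later when the lower end is tested, and is undone by
  moving to the parent interval.\<close>

fun search :: "(nat \<Rightarrow> nat set) \<Rightarrow> (nat \<Rightarrow> pdt pmf) \<Rightarrow> nat \<Rightarrow> nat \<Rightarrow> nat \<Rightarrow> pdt pmf" where
  "search W k 0 l j = k j"
| "search W k (Suc N) 0 j =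
     test_twice (W j) (search W k N 0 j) (search W k N 1 (j div 2))"
| "search W k (Suc N) (Suc l) j =
     test_twice (W (j * 2 ^ Suc l))
       (test_twice (W ((2 * j + 1) * 2 ^ l)) (search W k N l (2 * j + 1)) (search W k N l (2 * j)))
       (search W k N (Suc (Suc l)) (j div 2))"

lemma rpdt_on_search:
  assumes "\<And>m. W m \<subseteq> {..<n}" "\<And>i. rpdt_on n (k i)"
  shows "rpdt_on n (search W k N l j)"
proof (induction N arbitrary: l j)
  case (Suc N)
  then show ?case by (cases l) (simp_all add: rpdt_on_test_twice assms)
qed (simp add: assms)

context path_cost
begin

text \<open>Worst case, whatever the answers are: a step runs at most two double tests, hence makes
  at most four queries.\<close>

lemma \<Phi>_search_le:
  assumes W: "\<And>m. W m \<subseteq> {..<n}" and k: "\<And>i. \<Phi> (k i) \<le> ennreal M" and "0 \<le> M"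
  shows "\<Phi> (search W k N l j) \<le> ennreal (M + 4 * real N * c)"
proof -
  have *: "\<Phi> (search W k N l j) \<le> 0 + ennreal (M + 4 * real N * c)" for N l j
  proof (induction N arbitrary: l j)
    case 0
    then show ?case using k by simp
  next
    case (Suc N)
    have nn: "0 \<le> M + 4 * real N * c" "0 \<le> 2 * c + (M + 4 * real N * c)"
      using c_nonneg \<open>0 \<le> M\<close> by auto
    have up: "0 + ennreal (M + 4 * real N * c) \<le> 0 + ennreal (2 * c + (M + 4 * real N * c))"
      using c_nonneg by (intro add_left_mono ennreal_leI) auto
    have inner: "\<Phi> (test_twice (W m) (search W k N l i) (search W k N l' i'))
        \<le> 0 + ennreal (2 * c + (M + 4 * real N * c))" for m l l' i i'
      by (intro \<Phi>_test_twice W Suc.IH nn)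
    have outer: "\<Phi> (test_twice (W m) P (search W k N l' i'))
        \<le> 0 + ennreal (2 * c + (2 * c + (M + 4 * real N * c)))"
      if "\<Phi> P \<le> 0 + ennreal (2 * c + (M + 4 * real N * c))" for P m l' i'
      by (intro \<Phi>_test_twice W that order.trans[OF Suc.IH up] nn)
    have "\<Phi> (search W k (Suc N) l j) \<le> 0 + ennreal (2 * c + (2 * c + (M + 4 * real N * c)))"
    proof (cases l)
      case 0
      then show ?thesis using outer[OF order.trans[OF Suc.IH up]] by simp
    next
      case (Suc l')
      show ?thesis unfolding Suc search.simps by (rule outer[OF inner])
    qed
    then show ?case by (simp add: algebra_simps)
  qed
  then show ?thesis by simp
qed

text \<open>A test on a set without a 1 never errs, so a search at a leaf whose lower end passes
  stays there for good.\<close>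

lemma \<Phi>_search_leaf:
  assumes W: "\<And>m. W m \<subseteq> {..<n}" and zero: "zero_on x (W j)"
  shows "\<Phi> (search W k N 0 j) \<le> \<Phi> (k j) + ennreal (4 * real N * c)"
proof (induction N)
  case (Suc N)
  have "\<Phi> (search W k (Suc N) 0 j) \<le> \<Phi> (k j) + ennreal (2 * c + 4 * real N * c)"
    unfolding search.simps by (intro \<Phi>_test_twice_zero W zero Suc.IH) (use c_nonneg in auto)
  also have "\<dots> \<le> \<Phi> (k j) + ennreal (4 * real (Suc N) * c)"
    using c_nonneg by (intro add_left_mono ennreal_leI) (auto simp: algebra_simps)
  finally show ?case .
qed simp

text \<open>Without a 1 no test can err, and the search always takes the right child until it is at
  the rightmost leaf; \<open>l \<le> N\<close> leaves enough steps to get there.\<close>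

lemma \<Phi>_search_all_zero:
  assumes W: "\<And>m. W m \<subseteq> {..<n}" and zero: "\<And>m. zero_on x (W m)"
  shows "l \<le> N \<Longrightarrow>
    \<Phi> (search W k N l j) \<le> \<Phi> (k ((j + 1) * 2 ^ l - 1)) + ennreal (4 * real N * c)"
proof (induction N arbitrary: l j)
  case (Suc N)
  show ?case
  proof (cases l)
    case 0
    then show ?thesis using \<Phi>_search_leaf[of W j k "Suc N"] W zero by simp
  next
    case (Suc l')
    have "\<Phi> (search W k (Suc N) (Suc l') j)
        \<le> \<Phi> (k ((2 * j + 1 + 1) * 2 ^ l' - 1)) + ennreal (2 * c + (2 * c + 4 * real N * c))"
      unfolding search.simps using Suc.prems \<open>l = Suc l'\<close> c_nonneg
      by (intro \<Phi>_test_twice_zero W zero Suc.IH) auto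
    then show ?thesis using \<open>l = Suc l'\<close> by (simp add: algebra_simps)
  qed
qed simp

text \<open>\<open>2 * g - l\<close> bounds the distance in the tree of dyadic intervals from the current one to
  the target: up to the level \<open>g\<close> of a common ancestor, and down to level 0. Every step decreases
  this distance with probability at least 3/4, and otherwise increases it by at most 1.\<close>

lemma \<Phi>_search:
  assumes W: "\<And>m. W m \<subseteq> {..<n}" and tgt: "\<And>m. zero_on x (W m) \<longleftrightarrow> m \<le> ms"
    and k: "\<And>i. \<Phi> (k i) \<le> ennreal M" and M: "0 \<le> M"
  shows "l \<le> g \<Longrightarrow> ms div 2 ^ g = j div 2 ^ (g - l) \<Longrightarrow> ms div 2 ^ l \<le> j \<Longrightarrow>
    \<Phi> (search W k N l j)
      \<le> \<Phi> (k ms) + ennreal (4 * real N * c + M * (7/8) ^ N * 2 ^ (2 * g - l))"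
proof (induction N arbitrary: l j g)
  case 0
  have "\<Phi> (k j) \<le> ennreal M" by (rule k)
  also have "M \<le> M * 2 ^ (2 * g - l)" using M by (simp add: mult_le_cancel_left1)
  finally have "\<Phi> (k j) \<le> ennreal (M * 2 ^ (2 * g - l))" by (simp add: ennreal_leI)
  then show ?case by (simp add: add_increasing)
next
  case (Suc N)
  let ?A = "\<Phi> (k ms)"
  define q where "q = M * (7/8) ^ N"
  have q: "0 \<le> q" using M by (simp add: q_def)
  have IH: "\<Phi> (search W k N l j) \<le> ?A + ennreal (4 * real N * c + q * 2 ^ (2 * g - l))"
    if "l \<le> g" "ms div 2 ^ g = j div 2 ^ (g - l)" "ms div 2 ^ l \<le> j" for l g j
    using Suc.IH that by (simp add: q_def)
  \<comment> \<open>The budget of one step: four queries, and a potential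
    \<open>2 ^ (2 * g - l)\<close> that shrinks by 7/8 = 3/4 * 1/2 + 1/4 * 2 on average.\<close>
  have fin: "\<Phi> (search W k (Suc N) l j)
      \<le> ?A + ennreal (4 * real (Suc N) * c + M * (7/8) ^ Suc N * 2 ^ (2 * g - l))"
    if "\<Phi> (search W k (Suc N) l j) \<le> ?A + ennreal e"
      "e \<le> 4 * c + 4 * real N * c + q * (7/8) * 2 ^ (2 * g - l)" for e
    using that by (elim order.trans) (auto intro!: add_left_mono ennreal_leI
        simp: q_def algebra_simps)
  have nn: "0 \<le> 4 * real N * c + q * 2 ^ i" "0 \<le> 2 * c + (4 * real N * c + q * 2 ^ i)" for i
    using c_nonneg q by auto
  show ?case
  proof (cases "j * 2 ^ l \<le> ms")
    case lo: True
    then have j: "j = ms div 2 ^ l"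
      using Suc.prems(3) by (metis dual_order.antisym less_eq_div_iff_mult_less_eq zero_less_numeral zero_less_power)
    show ?thesis
    proof (cases l)
      case 0
      then have "\<Phi> (search W k (Suc N) l j) \<le> ?A + ennreal (4 * real (Suc N) * c)"
        using \<Phi>_search_leaf[of W ms k "Suc N"] W tgt j by simp
      then show ?thesis by (rule fin) (use q in \<open>auto simp: algebra_simps\<close>)
    next
      case (Suc l')
      \<comment> \<open>Since \<open>l \<le> g\<close> gives \<open>l \<le> 2 * g - l\<close>, the
        potential of a child containing the target is at most half of the present one.\<close>
      have pw: "2 * 2 ^ l' \<le> (2::real) ^ (2 * g - l)"
        unfolding power_Suc[symmetric] using Suc.prems(1) Suc by (intro power_increasing) auto
      have pw': "8 * 2 ^ l' \<le> 7 * (2::real) ^ (2 * g - l)"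
        using pw zero_le_power[of "2::real" "2 * g - l"] by linarith
      have jj: "j = ms div 2 ^ l' div 2" using j Suc by (simp only: power_Suc2 div_mult2_eq)
      show ?thesis
      proof (cases "(2 * j + 1) * 2 ^ l' \<le> ms")
        case True
        then have "2 * j + 1 \<le> ms div 2 ^ l'" by (simp add: less_eq_div_iff_mult_less_eq)
        then have "ms div 2 ^ l' = 2 * j + 1" using jj by linarith
        then have "\<Phi> (search W k (Suc N) (Suc l') j)
            \<le> ?A + ennreal (2 * c + (2 * c + (4 * real N * c + q * 2 ^ (2 * l' - l'))))"
          unfolding search.simps using lo True Suc
          by (intro \<Phi>_test_twice_zero W nn IH) (auto simp: tgt)
        then show ?thesis unfolding Suc[symmetric]
          by (rule fin) (use mult_left_mono[OF pw' q] in \<open>auto simp: algebra_simps\<close>)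
      next
        case False
        then have "ms div 2 ^ l' < 2 * j + 1"
          by (meson div_less_iff_less_mult not_le zero_less_numeral zero_less_power)
        then have *: "ms div 2 ^ l' = 2 * j" using jj by linarith
        let ?e1 = "4 * real N * c + q * 2 ^ (2 * l' - l')"
        \<comment> \<open>The wrong child is entered with probability 1/4. It meets the target at
          level \<open>Suc l'\<close>, so its potential is four times that of the right child, and
          (4 + 3) / 4 = 2 * 7/8.\<close>
        let ?e0 = "4 * real N * c + q * (4 * 2 ^ l')"
        have "2 * Suc l' - l' = Suc (Suc l')" by simp
        then have pw4: "(2::real) ^ (2 * Suc l' - l') = 4 * 2 ^ l'" by simp
        have nn': "0 \<le> ?e0" "0 \<le> ?e1" "0 \<le> 2 * c + (?e0 + 3 * ?e1) / 4"
          using c_nonneg q by auto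
        have left: "\<Phi> (search W k N l' (2 * j)) \<le> ?A + ennreal ?e1"
          using * by (intro IH) auto
        have right: "\<Phi> (search W k N l' (2 * j + 1)) \<le> ?A + ennreal ?e0"
          unfolding pw4[symmetric] using * jj by (intro IH) (auto simp: power_Suc2 div_mult2_eq simp del: power_Suc)
        have nz: "\<not> zero_on x (W ((2 * j + 1) * 2 ^ l'))" using False tgt by blast
        have z: "zero_on x (W (j * 2 ^ Suc l'))" using lo Suc tgt by blast
        have "\<Phi> (search W k (Suc N) (Suc l') j)
            \<le> ?A + ennreal (2 * c + (2 * c + (?e0 + 3 * ?e1) / 4))"
          unfolding search.simps
          by (intro \<Phi>_test_twice_zero[OF W z _ nn'(3)]
              \<Phi>_test_twice_nonzero[OF W nz right left nn'(1,2)])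
        then show ?thesis unfolding Suc[symmetric]
          by (rule fin) (use mult_left_mono[OF pw q] q in \<open>auto simp: algebra_simps\<close>)
      qed
    qed
  next
    case lo: False
    then have less: "ms div 2 ^ l < j"
      by (meson div_less_iff_less_mult not_le zero_less_numeral zero_less_power)
    \<comment> \<open>At level \<open>g\<close> the interval would be the common ancestor itself and
      contain the target.\<close>
    then have "l \<noteq> g" using Suc.prems(2) by auto
    then have lg: "l < g" using Suc.prems(1) by simp
    define r where "r = 2 * g - l - 1"
    have r: "2 * g - l = Suc r" "2 * g - Suc l = r" using lg by (auto simp: r_def)
    have up: "\<Phi> (search W k N (Suc l) (j div 2)) \<le> ?A + ennreal (4 * real N * c + q * 2 ^ r)"
      unfolding r(2)[symmetric]
    proof (rule IH)
      show "ms div 2 ^ g = j div 2 div 2 ^ (g - Suc l)"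
        using Suc.prems(2) lg
        by (simp add: Suc_diff_Suc flip: div_mult2_eq power_Suc)
      show "ms div 2 ^ Suc l \<le> j div 2"
        using less by (simp only: power_Suc2 div_mult2_eq)
    qed (use lg in auto)
    \<comment> \<open>Going up leaves distance \<open>r\<close>; a missed 1 leads down and leaves
      \<open>r + 2\<close>. The mean potential is (4 + 3) / 4 * \<open>2 ^ r\<close>, which is 7/8
      of the present \<open>2 ^ (r + 1)\<close>.\<close>
    let ?e0 = "2 * c + (4 * real N * c + q * 2 ^ (Suc (Suc r)))"
    let ?e1 = "4 * real N * c + q * 2 ^ r"
    have down: "\<exists>P. search W k (Suc N) l j = test_twice (W (j * 2 ^ l)) P (search W k N (Suc l) (j div 2))
        \<and> \<Phi> P \<le> ?A + ennreal ?e0"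
    proof (cases l)
      case 0
      \<comment> \<open>A leaf has no children: after a missed 1 the search stays, at distance
        \<open>r + 1\<close> instead of \<open>r + 2\<close>.\<close>
      have "\<Phi> (search W k N 0 j) \<le> ?A + ennreal (4 * real N * c + q * 2 ^ (2 * g - 0))"
        using Suc.prems 0 by (intro IH) auto
      also have "\<dots> \<le> ?A + ennreal ?e0"
        using r c_nonneg q 0 by (intro add_left_mono ennreal_leI) auto
      finally show ?thesis using 0 by auto
    next
      case (Suc l')
      have child: "\<Phi> (search W k N l' i) \<le> ?A + ennreal (4 * real N * c + q * 2 ^ (Suc (Suc r)))"
        if i: "i div 2 = j" for i
      proof -
        have "2 * g - l' = Suc (Suc r)" using Suc r lg by auto
        moreover have "\<Phi> (search W k N l' i) \<le> ?A + ennreal (4 * real N * c + q * 2 ^ (2 * g - l'))"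
        proof (rule IH)
          have "g - l' = Suc (g - l)" using Suc lg by auto
          then show "ms div 2 ^ g = i div 2 ^ (g - l')"
            using Suc.prems(2) i by (simp add: div_mult2_eq)
          have "ms div 2 ^ l' div 2 < j"
            using less Suc by (simp only: power_Suc2 div_mult2_eq)
          then show "ms div 2 ^ l' \<le> i" using i by linarith
        qed (use Suc lg in auto)
        ultimately show ?thesis by simp
      qed
      have "\<Phi> (test_twice (W ((2 * j + 1) * 2 ^ l')) (search W k N l' (2 * j + 1)) (search W k N l' (2 * j)))
          \<le> ?A + ennreal ?e0"
        by (intro \<Phi>_test_twice W child nn) auto
      then show ?thesis using Suc by auto
    qed
    then obtain P where P: "search W k (Suc N) l j =
        test_twice (W (j * 2 ^ l)) P (search W k N (Suc l) (j div 2))"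
      "\<Phi> P \<le> ?A + ennreal ?e0" by blast
    have "\<Phi> (search W k (Suc N) l j) \<le> ?A + ennreal (2 * c + (?e0 + 3 * ?e1) / 4)"
      unfolding P(1) by (intro \<Phi>_test_twice_nonzero W P(2) up nn) (use lo tgt in auto)
    then show ?thesis
      by (rule fin) (use r c_nonneg q in \<open>auto simp: field_simps\<close>)
  qed
qed

end

section \<open>Finding the first 1 in a list of coordinates\<close>

text \<open>First occurrences are kept, as opposed to \<open>remdups\<close>, so that the first
  coordinate carrying a 1 is the same; the length drops to at most \<open>n\<close>.\<close>

primrec dedup :: "'a list \<Rightarrow> 'a list" where
  "dedup [] = []"
| "dedup (y # ys) = y # removeAll y (dedup ys)"

lemma set_dedup [simp]: "set (dedup ys) = set ys"
  by (induction ys) auto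

lemma distinct_dedup [simp]: "distinct (dedup ys)"
  by (induction ys) (auto simp: distinct_removeAll)

lemma find_removeAll: "\<not> P y \<Longrightarrow> find P (removeAll y ys) = find P ys"
  by (induction ys) auto

lemma find_dedup [simp]: "find P (dedup ys) = find P ys"
  by (induction ys) (auto simp: find_removeAll)

lemma find_append: "find P (xs @ ys) = (case find P xs of None \<Rightarrow> find P ys | Some p \<Rightarrow> Some p)"
  by (induction xs) auto

lemma find_conv_takeWhile:
  defines "k \<equiv> \<lambda>P xs. length (takeWhile (\<lambda>y. \<not> P y) xs)"
  shows "find P xs = (if k P xs < length xs then Some (xs ! k P xs) else None)"
  unfolding k_def by (induction xs) auto

context path_cost
begin

text \<open>The position of the first 1 is the largest \<open>m\<close> for which the prefix of
  length \<open>m\<close> vanishes, which is what the search locates. Leaves from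
  \<open>length cs\<close> on stand for \<open>None\<close>, and \<open>n < 2 ^ d\<close> ensures
  that there is one.\<close>

lemma \<Phi>_search_find:
  assumes cs: "distinct cs" "set cs \<subseteq> {..<n}" and d: "n < 2 ^ d" "d \<le> N"
    and k: "\<And>h. \<Phi> (k h) \<le> ennreal M" and M: "0 \<le> M"
  shows "\<Phi> (search (\<lambda>m. set (take m cs)) (\<lambda>i. k (if i < length cs then Some (cs ! i) else None)) N d 0)
    \<le> \<Phi> (k (find (\<lambda>i. x i = 1) cs)) + ennreal (4 * real N * c + M * ((7/8) ^ N * 2 ^ d))"
    (is "\<Phi> (search ?W ?k N d 0) \<le> _")
proof -
  define ms where "ms = length (takeWhile (\<lambda>i. x i = 0) cs)"
  have find: "find (\<lambda>i. x i = 1) cs = (if ms < length cs then Some (cs ! ms) else None)"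
    using find_conv_takeWhile[of "\<lambda>i. x i = 1" cs] by (simp add: ms_def)
  have len: "length cs \<le> n"
    using card_mono[OF _ cs(2)] distinct_card[OF cs(1)] by simp
  have W: "?W m \<subseteq> {..<n}" for m
    using cs(2) set_take_subset by fastforce
  have below: "zero_on x (?W m)" if "m \<le> ms" for m
  proof -
    have "take ms cs = takeWhile (\<lambda>i. x i = 0) cs"
      unfolding ms_def by (metis takeWhile_eq_take)
    then have "zero_on x (?W ms)"
      by (auto simp: zero_on_def dest: set_takeWhileD)
    moreover have "?W m \<subseteq> ?W ms" using that by (rule set_take_subset_set_take)
    ultimately show ?thesis by (auto simp: zero_on_def)
  qed
  show ?thesis
  proof (cases "ms < length cs")
    case True
    have "\<not> zero_on x (?W m)" if "ms < m" for m
    proof -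
      have "x (cs ! ms) = 1" using nth_length_takeWhile[of "\<lambda>i. x i = 0" cs] True
        by (simp add: ms_def)
      moreover have "cs ! ms \<in> ?W m" using that True by (auto simp: in_set_conv_nth intro!: exI[of _ ms])
      ultimately show ?thesis by (auto simp: zero_on_def)
    qed
    then have tgt: "zero_on x (?W m) \<longleftrightarrow> m \<le> ms" for m
      using below by (meson not_le)
    \<comment> \<open>The target lies in the initial interval, so \<open>g = d\<close> is admissible
      and the initial potential is \<open>2 ^ d\<close>.\<close>
    have "ms < 2 ^ d" using True len d(1) by linarith
    then have "\<Phi> (search ?W ?k N d 0)
        \<le> \<Phi> (?k ms) + ennreal (4 * real N * c + M * (7/8) ^ N * 2 ^ (2 * d - d))"
      by (intro \<Phi>_search W tgt k M) auto
    then show ?thesis using True by (simp add: find mult.assoc)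
  next
    case False
    then have "ms = length cs" using length_takeWhile_le[of _ cs] by (metis le_neq_implies_less ms_def)
    then have zero: "zero_on x (?W m)" for m
      using below[of m] below[of ms] by (cases "m \<le> ms") auto
    have "\<Phi> (search ?W ?k N d 0) \<le> \<Phi> (?k ((0 + 1) * 2 ^ d - 1)) + ennreal (4 * real N * c)"
      by (intro \<Phi>_search_all_zero W zero d)
    also have "\<not> 2 ^ d - 1 < length cs" using len d(1) by linarith
    then have "?k ((0 + 1) * 2 ^ d - 1) = k (find (\<lambda>i. x i = 1) cs)"
      using False by (simp add: find)
    also have "\<Phi> \<dots> + ennreal (4 * real N * c)
        \<le> \<Phi> \<dots> + ennreal (4 * real N * c + M * ((7/8) ^ N * 2 ^ d))"
      using M by (intro add_left_mono ennreal_leI) auto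
    finally show ?thesis .
  qed
qed

end

section \<open>Simulating the pruned tree\<close>

definition agree :: "nat set \<Rightarrow> (nat \<Rightarrow> bit) \<Rightarrow> (nat \<Rightarrow> bit) \<Rightarrow> bool" where
  "agree D u v \<longleftrightarrow> (\<forall>i\<in>D. u i = v i)"

text \<open>For a linear span \<open>V\<close> this is linear dependence of the restrictions to
  \<open>D\<close>. The vectors in \<open>V\<close> stay unrestricted because \<open>D\<close> grows
  during the run.\<close>

definition spanned :: "nat set \<Rightarrow> ((nat \<Rightarrow> bit) \<times> bit) set \<Rightarrow> (nat \<Rightarrow> bit) \<Rightarrow> bool" where
  "spanned D V a \<longleftrightarrow> (\<exists>p\<in>V. agree D (fst p) a)"

definition rep :: "nat set \<Rightarrow> ((nat \<Rightarrow> bit) \<times> bit) set \<Rightarrow> (nat \<Rightarrow> bit) \<Rightarrow> (nat \<Rightarrow> bit) \<times> bit" where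
  "rep D V a = (SOME p. p \<in> V \<and> agree D (fst p) a)"

text \<open>Over the two-element field, adjoining one vector to a span adds a single
  translate.\<close>

definition extend ::
  "((nat \<Rightarrow> bit) \<times> bit) set \<Rightarrow> (nat \<Rightarrow> bit) \<Rightarrow> bit \<Rightarrow> ((nat \<Rightarrow> bit) \<times> bit) set" where
  "extend V a b = V \<union> (\<lambda>p. (\<lambda>i. a i + fst p i, b + snd p)) ` V"

text \<open>If \<open>D\<close> contains all stars, then the query \<open>a\<close> has the answer \<open>snd (rep D V a)\<close>. This answer
  is correct as soon as \<open>x\<close> vanishes where \<open>a\<close> and \<open>fst (rep D V a)\<close> differ.\<close>

primrec path_coords :: "nat \<Rightarrow> nat set \<Rightarrow> ((nat \<Rightarrow> bit) \<times> bit) set \<Rightarrow> pdt \<Rightarrow> nat list" where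
  "path_coords n D V (Leaf b) = []"
| "path_coords n D V (Query a T0 T1) =
     (if spanned D V a
      then filter (\<lambda>i. a i \<noteq> fst (rep D V a) i) [0..<n] @
        (if snd (rep D V a) = 0 then path_coords n D V T0 else path_coords n D V T1)
      else [])"

text \<open>\<open>h\<close> is the outcome of the search. The walk stops at the first query for
  which \<open>h\<close> was collected, since the predicted answer is not reliable there.\<close>

primrec stop_at :: "nat set \<Rightarrow> ((nat \<Rightarrow> bit) \<times> bit) set \<Rightarrow> nat option \<Rightarrow> pdt \<Rightarrow> pdt" where
  "stop_at D V h (Leaf b) = Leaf b"
| "stop_at D V h (Query a T0 T1) =
     (if spanned D V a \<and> agree (set_option h) a (fst (rep D V a))
      then (if snd (rep D V a) = 0 then stop_at D V h T0 else stop_at D V h T1)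
      else Query a T0 T1)"

text \<open>A coordinate found by the search carries a 1 and is therefore a star, so it joins
  \<open>D\<close>. The query at which the walk stopped is then really asked.\<close>

definition resume ::
  "(nat set \<Rightarrow> ((nat \<Rightarrow> bit) \<times> bit) set \<Rightarrow> pdt \<Rightarrow> pdt pmf) \<Rightarrow>
   nat set \<Rightarrow> ((nat \<Rightarrow> bit) \<times> bit) set \<Rightarrow> pdt \<Rightarrow> nat option \<Rightarrow> pdt pmf" where
  "resume R D V T h = (case stop_at D V h T of
     Leaf b \<Rightarrow> return_pmf (Leaf b)
   | Query a T0 T1 \<Rightarrow> query_pmf a
       (R (D \<union> set_option h) (extend V a 0) T0) (R (D \<union> set_option h) (extend V a 1) T1))"

text \<open>\<open>N\<close> is the number of steps of each search, \<open>d\<close> its initial level, and the fourth argument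
  the number of rounds.\<close>

primrec sim ::
  "nat \<Rightarrow> nat \<Rightarrow> nat \<Rightarrow> nat \<Rightarrow> nat set \<Rightarrow> ((nat \<Rightarrow> bit) \<times> bit) set \<Rightarrow> pdt \<Rightarrow> pdt pmf" where
  "sim n N d 0 = (\<lambda>D V T. return_pmf (Leaf 0))"
| "sim n N d (Suc f) = (\<lambda>D V T. let cs = dedup (path_coords n D V T)
     in search (\<lambda>m. set (take m cs))
          (\<lambda>i. resume (sim n N d f) D V T (if i < length cs then Some (cs ! i) else None)) N d 0)"

text \<open>This is the number of queries that the restricted tree with star set \<open>S\<close>
  makes on \<open>x\<close>; see \<open>num_queries_restrict\<close>.\<close>

primrec kept :: "nat \<Rightarrow> (nat \<Rightarrow> bit) \<Rightarrow> nat set \<Rightarrow> ((nat \<Rightarrow> bit) \<times> bit) set \<Rightarrow> pdt \<Rightarrow> nat" where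
  "kept n x S V (Leaf b) = 0"
| "kept n x S V (Query a T0 T1) =
     (if spanned S V a then (if ip n a x = 0 then kept n x S V T0 else kept n x S V T1)
      else Suc (if ip n a x = 0 then kept n x S (extend V a 0) T0
                else kept n x S (extend V a 1) T1))"

lemma rep_spanned:
  assumes "spanned D V a"
  shows "rep D V a \<in> V" "agree D (fst (rep D V a)) a"
proof -
  have "\<exists>p. p \<in> V \<and> agree D (fst p) a" using assms by (auto simp: spanned_def)
  from someI_ex[OF this] show "rep D V a \<in> V" "agree D (fst (rep D V a)) a"
    by (simp_all add: rep_def)
qed

lemma set_path_coords: "set (path_coords n D V T) \<subseteq> {..<n}"
  by (induction T) auto

lemma pdt_on_stop_at: "pdt_on n T \<Longrightarrow> pdt_on n (stop_at D V h T)"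
  by (induction T) auto

lemma prefix_path_coords: "set (take m (dedup (path_coords n D V T))) \<subseteq> {..<n}"
  using set_path_coords set_take_subset set_dedup by (metis subset_trans)

lemma rpdt_on_sim: "pdt_on n T \<Longrightarrow> rpdt_on n (sim n N d f D V T)"
proof (induction f arbitrary: D V T)
  case (Suc f)
  have "rpdt_on n (resume (sim n N d f) D V T h)" for h
    using pdt_on_stop_at[OF Suc.prems, of D V h]
    by (cases "stop_at D V h T")
      (auto simp: resume_def rpdt_on_def[of _ "return_pmf _"] intro!: rpdt_on_query_pmf Suc.IH)
  then show ?case
    unfolding sim.simps Let_def by (intro rpdt_on_search prefix_path_coords)
qed (simp add: rpdt_on_def)

text \<open>\<open>V\<close> is the span of the answered queries, and restriction to \<open>D\<close> is injective on it.\<close>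

definition answered :: "nat \<Rightarrow> (nat \<Rightarrow> bit) \<Rightarrow> nat set \<Rightarrow> ((nat \<Rightarrow> bit) \<times> bit) set \<Rightarrow> bool" where
  "answered n x D V \<longleftrightarrow>
     fst ` V \<subseteq> cube n \<and> ((\<lambda>_. 0), 0) \<in> V \<and>
     (\<forall>p\<in>V. \<forall>q\<in>V. (\<lambda>i. fst p i + fst q i, snd p + snd q) \<in> V) \<and>
     (\<forall>p\<in>V. snd p = ip n (fst p) x) \<and>
     (\<forall>p\<in>V. agree D (fst p) (\<lambda>_. 0) \<longrightarrow> fst p = (\<lambda>_. 0))"

lemma bit_add_self [simp]: "b + b = 0" for b :: bit
  by (simp add: bit_add_eq_0_iff)

lemma bit_add_left_self [simp]: "a + (a + b) = b" for a b :: bit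
  by (simp flip: add.assoc)

lemma agree_add_zero: "agree D (\<lambda>i. a i + b i) (\<lambda>_. 0) \<longleftrightarrow> agree D a b"
  by (simp add: agree_def bit_add_eq_0_iff)

lemma ip_zero [simp]: "ip n (\<lambda>_. 0) x = 0"
  by (simp add: ip_def)

lemma cube_add: "u \<in> cube n \<Longrightarrow> v \<in> cube n \<Longrightarrow> (\<lambda>i. u i + v i) \<in> cube n"
  by (simp add: cube_def)

lemma answered_init: "answered n x D {((\<lambda>_. 0), 0)}"
  by (simp add: answered_def cube_def)

lemma answeredD:
  assumes "answered n x D V"
  shows "fst ` V \<subseteq> cube n" "((\<lambda>_. 0), 0) \<in> V"
    and "\<And>p q. p \<in> V \<Longrightarrow> q \<in> V \<Longrightarrow> (\<lambda>i. fst p i + fst q i, snd p + snd q) \<in> V"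
    and "\<And>p. p \<in> V \<Longrightarrow> snd p = ip n (fst p) x"
    and "\<And>p. p \<in> V \<Longrightarrow> agree D (fst p) (\<lambda>_. 0) \<Longrightarrow> fst p = (\<lambda>_. 0)"
  using assms unfolding answered_def by blast+

lemma agree_antimono: "agree D' u v \<Longrightarrow> D \<subseteq> D' \<Longrightarrow> agree D u v"
  by (auto simp: agree_def)

lemma answered_mono:
  assumes V: "answered n x D V" and "D \<subseteq> D'"
  shows "answered n x D' V"
  unfolding answered_def
proof (intro conjI ballI impI)
  show "fst p = (\<lambda>_. 0)" if "p \<in> V" "agree D' (fst p) (\<lambda>_. 0)" for p
    using that agree_antimono assms by (intro answeredD(5)[OF V]) auto
qed (rule answeredD[OF V]; assumption)+

lemma extend_cases:
  assumes "p \<in> extend V a b"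
  obtains "p \<in> V" | q where "q \<in> V" "p = (\<lambda>i. a i + fst q i, b + snd q)"
  using assms unfolding extend_def by blast

lemma extend_in: "p \<in> V \<Longrightarrow> (\<lambda>i. e * a i + fst p i, e * b + snd p) \<in> extend V a b"
  by (cases e) (auto simp: extend_def)

lemma in_extend_iff:
  "p \<in> extend V a b \<longleftrightarrow> (\<exists>e. \<exists>q\<in>V. p = (\<lambda>i. e * a i + fst q i, e * b + snd q))"
proof
  assume "p \<in> extend V a b"
  then show "\<exists>e. \<exists>q\<in>V. p = (\<lambda>i. e * a i + fst q i, e * b + snd q)"
  proof (cases rule: extend_cases)
    case 1
    then show ?thesis by (intro exI[of _ 0] bexI[of _ p]) auto
  next
    case (2 q)
    then show ?thesis by (intro exI[of _ 1] bexI[of _ q]) auto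
  qed
qed (use extend_in in blast)

text \<open>Injectivity on \<open>D\<close> survives: if the new vector \<open>a + q\<close>
  vanished on \<open>D\<close>, then \<open>q\<close> would agree with \<open>a\<close> there and
  \<open>a\<close> would be spanned.\<close>

lemma answered_extend:
  assumes V: "answered n x D V" and a: "a \<in> cube n" "\<not> spanned D V a"
  shows "answered n x D (extend V a (ip n a x))"
  unfolding answered_def
proof (intro conjI ballI impI)
  let ?b = "ip n a x"
  note V' = answeredD[OF V]
  show "fst ` extend V a ?b \<subseteq> cube n"
    using V'(1) a(1) by (auto simp: extend_def intro!: cube_add)
  show "((\<lambda>_. 0), 0) \<in> extend V a ?b" using V'(2) by (simp add: extend_def)
  show "(\<lambda>i. fst p i + fst q i, snd p + snd q) \<in> extend V a ?b"
    if pq: "p \<in> extend V a ?b" "q \<in> extend V a ?b" for p q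
  proof -
    obtain e p' where p: "p' \<in> V" "p = (\<lambda>i. e * a i + fst p' i, e * ?b + snd p')"
      using pq(1) unfolding in_extend_iff by blast
    obtain e' q' where q: "q' \<in> V" "q = (\<lambda>i. e' * a i + fst q' i, e' * ?b + snd q')"
      using pq(2) unfolding in_extend_iff by blast
    have "(\<lambda>i. fst p i + fst q i, snd p + snd q)
        = (\<lambda>i. (e + e') * a i + (fst p' i + fst q' i), (e + e') * ?b + (snd p' + snd q'))"
      using p(2) q(2) by (simp add: algebra_simps)
    then show ?thesis
      using extend_in[OF V'(3)[OF p(1) q(1)], of "e + e'" a ?b] by simp
  qed
  show "snd p = ip n (fst p) x" if "p \<in> extend V a ?b" for p
    using that by (cases rule: extend_cases) (simp_all add: V'(4) ip_add)
  show "fst p = (\<lambda>_. 0)" if p: "p \<in> extend V a ?b" and z: "agree D (fst p) (\<lambda>_. 0)" for p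
    using p
  proof (cases rule: extend_cases)
    case 1
    then show ?thesis using V'(5) z by blast
  next
    case (2 q)
    then have "agree D (fst q) a"
      using z by (auto simp: agree_def bit_add_eq_0_iff)
    then show ?thesis using 2(1) a(2) unfolding spanned_def by blast
  qed
qed

section \<open>Size of the span of the answered queries\<close>

lemma finite_cube: "finite (cube n)" and card_cube: "card (cube n) = 2 ^ n"
proof -
  have *: "cube n = PiE_dflt {..<n} 0 (\<lambda>_. UNIV)"
    by (auto simp: cube_def PiE_dflt_def)
  show "finite (cube n)" unfolding * by (rule finite_masks) simp
  show "card (cube n) = 2 ^ n" unfolding * by (subst card_PiE_dflt) (auto simp: UNIV_bit numeral_2_eq_2)
qed

lemma answered_finite_card:
  assumes V: "answered n x D V"
  shows "finite V" "card V \<le> 2 ^ n"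
proof -
  have inj: "inj_on fst V" using answeredD(4)[OF V] by (auto simp: inj_on_def prod_eq_iff)
  have sub: "fst ` V \<subseteq> cube n" by (rule answeredD(1)[OF V])
  show "finite V" using finite_subset[OF sub finite_cube] inj finite_image_iff by blast
  show "card V \<le> 2 ^ n" using card_mono[OF finite_cube sub] card_image[OF inj] card_cube by simp
qed

text \<open>If \<open>V\<close> met its translate, \<open>a\<close> would be a sum of two members of
  \<open>V\<close> and hence spanned.\<close>

lemma card_extend:
  assumes V: "answered n x D V" and a: "\<not> spanned D V a"
  shows "card (extend V a b) = 2 * card V"
proof -
  let ?s = "\<lambda>p. (\<lambda>i. a i + fst p i, b + snd p)"
  have "inj_on ?s V"
    by (auto simp: inj_on_def prod_eq_iff fun_eq_iff)
  moreover have "V \<inter> ?s ` V = {}"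
  proof (rule ccontr)
    assume "V \<inter> ?s ` V \<noteq> {}"
    then obtain p q where pq: "p \<in> V" "q \<in> V" "q = ?s p" by blast
    have "(\<lambda>i. fst p i + fst q i, snd p + snd q) \<in> V"
      by (rule answeredD(3)[OF V pq(1,2)])
    moreover have "(\<lambda>i. fst p i + fst q i) = a" using pq by (auto simp: add.left_commute)
    ultimately have "spanned D V a" by (force simp: spanned_def agree_def)
    then show False using a by simp
  qed
  ultimately show ?thesis
    using answered_finite_card(1)[OF V] by (simp add: extend_def card_Un_disjoint card_image)
qed

text \<open>\<open>S\<close> is the set of all stars, \<open>D\<close> the set of those found so far.\<close>

definition partial_stars :: "nat \<Rightarrow> (nat \<Rightarrow> bit) \<Rightarrow> nat set \<Rightarrow> nat set \<Rightarrow> bool" where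
  "partial_stars n x S D \<longleftrightarrow>
     D \<subseteq> S \<and> S \<subseteq> {..<n} \<and> (\<forall>i\<in>S - D. x i = 1) \<and> (\<forall>i\<in>{..<n} - S. x i = 0)"

lemma ip_cong_agree:
  assumes "agree S a v" "\<forall>i\<in>{..<n} - S. x i = 0"
  shows "ip n a x = ip n v x"
  unfolding ip_def using assms by (intro sum.cong) (auto simp: agree_def)

text \<open>By injectivity on \<open>D\<close>, a member of \<open>V\<close> that agrees with
  \<open>a\<close> on the larger set \<open>S\<close> can only be \<open>rep D V a\<close>. So
  redundancy with respect to the unknown stars is decided by a vector that the algorithm
  knows.\<close>

lemma spanned_iff_agree_rep:
  assumes V: "answered n x D V" and D: "D \<subseteq> S" and sp: "spanned D V a"
  shows "spanned S V a \<longleftrightarrow> agree S (fst (rep D V a)) a"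
proof
  assume "spanned S V a"
  then obtain p where p: "p \<in> V" "agree S (fst p) a" by (auto simp: spanned_def)
  note r = rep_spanned[OF sp]
  have "(\<lambda>i. fst p i + fst (rep D V a) i) = (\<lambda>_. 0)"
  proof -
    have "(\<lambda>i. fst p i + fst (rep D V a) i, snd p + snd (rep D V a)) \<in> V"
      by (rule answeredD(3)[OF V p(1) r(1)])
    moreover have "agree D (\<lambda>i. fst p i + fst (rep D V a) i) (\<lambda>_. 0)"
      using p(2) r(2) D unfolding agree_add_zero by (auto simp: agree_def)
    ultimately show ?thesis using answeredD(5)[OF V] by fastforce
  qed
  then have "fst p = fst (rep D V a)"
    by (auto simp: fun_eq_iff bit_add_eq_0_iff)
  then show "agree S (fst (rep D V a)) a" using p(2) by simp
next
  assume "agree S (fst (rep D V a)) a"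
  then show "spanned S V a" using rep_spanned(1)[OF sp] by (auto simp: spanned_def)
qed

lemma spanned_antimono: "spanned D' V a \<Longrightarrow> D \<subseteq> D' \<Longrightarrow> spanned D V a"
  by (auto simp: spanned_def agree_def)

text \<open>Every skipped query is predicted correctly and is redundant for the full star set, so
  skipping it changes neither the output nor the count. The query where the walk stops is not
  redundant, and so can pay for the search.\<close>

lemma stop_at_find:
  assumes V: "answered n x D V" and S: "partial_stars n x S D"
  defines "h \<equiv> \<lambda>T. find (\<lambda>i. x i = 1) (path_coords n D V T)"
  shows "pdt_eval n (stop_at D V (h T) T) x = pdt_eval n T x"
    and "kept n x S V (stop_at D V (h T) T) = kept n x S V T"
    and "stop_at D V (h T) T = Query a T0 T1 \<Longrightarrow> \<not> spanned (D \<union> set_option (h T)) V a"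
proof -
  have "pdt_eval n (stop_at D V (h T) T) x = pdt_eval n T x \<and>
    kept n x S V (stop_at D V (h T) T) = kept n x S V T \<and>
    (\<forall>a T0 T1. stop_at D V (h T) T = Query a T0 T1 \<longrightarrow> \<not> spanned (D \<union> set_option (h T)) V a)"
  proof (induction T)
    case (Leaf b)
    then show ?case by simp
  next
    case (Query a T0 T1)
    let ?r = "rep D V a"
    let ?cs = "filter (\<lambda>i. a i \<noteq> fst ?r i) [0..<n]"
    let ?T = "if snd ?r = 0 then T0 else T1"
    show ?case
    proof (cases "spanned D V a")
      case False
      then show ?thesis using spanned_antimono by (auto simp: h_def)
    next
      case sp: True
      note r = rep_spanned[OF sp]
      show ?thesis
      proof (cases "find (\<lambda>i. x i = 1) ?cs")
        case None
        then have zero: "x i = 0" if "i < n" "a i \<noteq> fst ?r i" for i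
          using that by (auto simp: find_None_iff)
        \<comment> \<open>On \<open>D\<close> the representative agrees with \<open>a\<close> by
          choice; a star outside \<open>D\<close> carries a 1, so by \<open>zero\<close> it is no
          point of difference.\<close>
        then have agr: "agree S (fst ?r) a"
          using S r(2) by (force simp: agree_def partial_stars_def)
        then have ip: "ip n a x = snd ?r"
          using S answeredD(4)[OF V r(1)] ip_cong_agree[OF agr, of n x]
          by (simp add: partial_stars_def)
        have h: "h (Query a T0 T1) = h ?T"
          using None sp by (auto simp: h_def find_append)
        \<comment> \<open>The coordinate found further down carries a 1, so it is not among those
          collected here, where \<open>x\<close> vanishes. Hence \<open>stop_at\<close> passes this
          query.\<close>
        have "i < n \<and> x i = 1" if "h ?T = Some i" for i
          using that set_path_coords[of n D V ?T] unfolding h_def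
          by (auto simp: find_Some_iff dest: nth_mem)
        then have "a i = fst ?r i" if "h ?T = Some i" for i
          using zero[of i] that by (cases "a i = fst ?r i") auto
        then have "agree (set_option (h ?T)) a (fst ?r)"
          by (auto simp: agree_def)
        then have "stop_at D V (h (Query a T0 T1)) (Query a T0 T1) = stop_at D V (h ?T) ?T"
          using sp unfolding h by auto
        moreover have "spanned S V a" using agr r(1) by (auto simp: spanned_def)
        ultimately show ?thesis using Query ip h by (auto split: if_splits)
      next
        case (Some p)
        then have p: "p < n" "a p \<noteq> fst ?r p" "x p = 1"
          by (auto simp: find_Some_iff dest: nth_mem)
        have h: "h (Query a T0 T1) = Some p" using Some sp by (auto simp: h_def find_append)
        \<comment> \<open>The only candidate is \<open>rep D V a\<close>, and it differs from
          \<open>a\<close> at \<open>p\<close>.\<close>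
        have "\<not> spanned (D \<union> {p}) V a"
          using spanned_iff_agree_rep[OF V _ sp, of "D \<union> {p}"] p(2) by (auto simp: agree_def)
        then show ?thesis using h p(2) by (auto simp: agree_def)
      qed
    qed
  qed
  then show "pdt_eval n (stop_at D V (h T) T) x = pdt_eval n T x"
    and "kept n x S V (stop_at D V (h T) T) = kept n x S V T"
    and "stop_at D V (h T) T = Query a T0 T1 \<Longrightarrow> \<not> spanned (D \<union> set_option (h T)) V a"
    by blast+
qed

section \<open>Relation to restricted trees\<close>

fun span_of :: "((nat \<Rightarrow> bit) \<times> bit) list \<Rightarrow> ((nat \<Rightarrow> bit) \<times> bit) set" where
  "span_of [] = {((\<lambda>_. 0), 0)}"
| "span_of ((a, b) # qs) = extend (span_of qs) a b"

definition mask_vec :: "(nat \<Rightarrow> mark) \<Rightarrow> (nat \<Rightarrow> bit) \<Rightarrow> nat \<Rightarrow> bit" where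
  "mask_vec \<rho> a = (\<lambda>i. if \<rho> i = Star then a i else 0)"

lemma determined_Nil: "determined n [] a b \<longleftrightarrow> (\<forall>i<n. a i = 0) \<and> b = 0"
  by (simp add: determined_def)

lemma determined_Cons:
  "determined n (p # ps) a b \<longleftrightarrow>
     determined n ps a b \<or> determined n ps (\<lambda>i. fst p i + a i) (snd p + b)"
proof
  assume "determined n (p # ps) a b"
  then obtain c where c: "\<forall>i<n. a i = c 0 * fst p i + (\<Sum>j<length ps. c (Suc j) * fst (ps ! j) i)"
    "b = c 0 * snd p + (\<Sum>j<length ps. c (Suc j) * snd (ps ! j))"
    by (auto simp: determined_def sum.lessThan_Suc_shift simp del: sum.lessThan_Suc)
  show "determined n ps a b \<or> determined n ps (\<lambda>i. fst p i + a i) (snd p + b)"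
  proof (cases "c 0 = 0")
    case True
    then show ?thesis using c by (auto simp: determined_def intro!: exI[of _ "\<lambda>j. c (Suc j)"])
  next
    case False
    then show ?thesis using c by (auto simp: determined_def intro!: exI[of _ "\<lambda>j. c (Suc j)"])
  qed
next
  assume "determined n ps a b \<or> determined n ps (\<lambda>i. fst p i + a i) (snd p + b)"
  then show "determined n (p # ps) a b"
  proof
    assume "determined n ps a b"
    then obtain c where "\<forall>i<n. a i = (\<Sum>j<length ps. c j * fst (ps ! j) i)"
      "b = (\<Sum>j<length ps. c j * snd (ps ! j))" by (auto simp: determined_def)
    then show ?thesis
      by (auto simp: determined_def sum.lessThan_Suc_shift simp del: sum.lessThan_Suc
          intro!: exI[of _ "case_nat 0 c"])
  next
    assume "determined n ps (\<lambda>i. fst p i + a i) (snd p + b)"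
    then obtain c where c: "\<forall>i<n. fst p i + a i = (\<Sum>j<length ps. c j * fst (ps ! j) i)"
      "snd p + b = (\<Sum>j<length ps. c j * snd (ps ! j))" by (auto simp: determined_def)
    then show ?thesis
      by (auto simp: determined_def sum.lessThan_Suc_shift simp flip: c simp del: sum.lessThan_Suc
          intro!: exI[of _ "case_nat 1 c"])
  qed
qed

text \<open>Masking is linear, so the span of the masked queries is the masked span. This links
  \<open>prune\<close>, which sees masked queries, to \<open>kept\<close>, which stores full
  ones.\<close>

lemma determined_span:
  "determined n (map (\<lambda>(v, b). (mask_vec \<rho> v, b)) qs) a b \<longleftrightarrow>
     (\<exists>p\<in>span_of qs. (\<forall>i<n. mask_vec \<rho> (fst p) i = a i) \<and> snd p = b)"
proof (induction qs arbitrary: a b)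
  case Nil
  then show ?case by (auto simp: determined_Nil mask_vec_def)
next
  case (Cons q qs)
  obtain v c where q: "q = (v, c)" by fastforce
  have 1: "(\<forall>i<n. mask_vec \<rho> u i = mask_vec \<rho> v i + a i) \<longleftrightarrow>
      (\<forall>i<n. mask_vec \<rho> (\<lambda>i. v i + u i) i = a i)" for u
  proof (intro all_cong)
    show "mask_vec \<rho> u i = mask_vec \<rho> v i + a i \<longleftrightarrow> mask_vec \<rho> (\<lambda>i. v i + u i) i = a i" for i
      by (cases "\<rho> i"; cases "v i"; cases "u i"; cases "a i") (auto simp: mask_vec_def)
  qed
  have 2: "d = c + b \<longleftrightarrow> c + d = b" for d by auto
  show ?case
    by (simp add: q determined_Cons Cons.IH extend_def bex_Un 1 2)
qed

lemma ip_mask: "\<forall>i<n. \<rho> i \<noteq> Star \<longrightarrow> x i = 0 \<Longrightarrow> ip n (mask_vec \<rho> a) x = ip n a x"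
  unfolding ip_def mask_vec_def by (intro sum.cong) auto

text \<open>As \<open>x\<close> vanishes off the stars, masking does not change answers; a
  determined answer is therefore the true one, and both recursions take the same branches.\<close>

lemma num_queries_prune:
  assumes x: "\<forall>i<n. \<rho> i \<noteq> Star \<longrightarrow> x i = 0"
  shows "\<forall>p\<in>span_of qs. snd p = ip n (fst p) x \<Longrightarrow>
    num_queries n (prune n (map (\<lambda>(v, b). (mask_vec \<rho> v, b)) qs) (fix_zeros \<rho> T)) x
      = kept n x {i. i < n \<and> \<rho> i = Star} (span_of qs) T"
proof (induction T arbitrary: qs)
  case (Leaf b)
  then show ?case by simp
next
  case (Query a T0 T1)
  let ?S = "{i. i < n \<and> \<rho> i = Star}" and ?ps = "map (\<lambda>(v, b). (mask_vec \<rho> v, b)) qs"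
  have agr: "(\<forall>i<n. mask_vec \<rho> v i = mask_vec \<rho> a i) \<longleftrightarrow> agree ?S v a" for v
    by (auto simp: mask_vec_def agree_def)
  have ipv: "snd p = ip n a x" if "p \<in> span_of qs" "agree ?S (fst p) a" for p
    using ip_cong_agree[OF that(2), of n x] x Query.prems that(1) by auto
  have det: "determined n ?ps (mask_vec \<rho> a) b \<longleftrightarrow> spanned ?S (span_of qs) a \<and> b = ip n a x" for b
    unfolding determined_span agr spanned_def using ipv by auto
  have ext: "\<forall>p\<in>span_of ((a, ip n a x) # qs). snd p = ip n (fst p) x"
    using Query.prems by (auto simp: extend_def ip_add)
  have fz: "fix_zeros \<rho> (Query a T0 T1) = Query (mask_vec \<rho> a) (fix_zeros \<rho> T0) (fix_zeros \<rho> T1)"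
    by (simp add: mask_vec_def)
  show ?case
  proof (cases "ip n a x = 0")
    case True
    then show ?thesis using Query.IH(1)[OF Query.prems] Query.IH(1)[OF ext]
      unfolding fz by (simp add: det ip_mask[OF x])
  next
    case False
    then show ?thesis using Query.IH(2)[OF Query.prems] Query.IH(2)[OF ext]
      unfolding fz by (simp add: det ip_mask[OF x])
  qed
qed

lemma num_queries_restrict:
  assumes x: "\<forall>i<n. \<rho> i \<noteq> Star \<longrightarrow> x i = 0"
  shows "num_queries n (restrict_pdt n \<rho> T) x
    = kept n x {i. i < n \<and> \<rho> i = Star} {((\<lambda>_. 0), 0)} T"
  using num_queries_prune[OF x, of "[]" T] by (simp add: restrict_pdt_def)

section \<open>Cost and error of the simulation\<close>

text \<open>Covers both uses: \<open>c = 1\<close> with the query count, which is 0 at leaves, and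
  \<open>c = 0\<close> with the indicator of an output other than \<open>y\<close>.\<close>

locale path_cost_bounded = path_cost +
  fixes y :: bit
  assumes \<phi>_Leaf: "\<phi> (Leaf b) \<le> ennreal (of_bool (b \<noteq> y))"
begin

lemma \<Phi>_resume_le:
  assumes R: "\<And>D V T. \<Phi> (R D V T) \<le> ennreal B" and B: "1 \<le> B"
  shows "\<Phi> (resume R D V T h) \<le> ennreal (c + B)"
proof (cases "stop_at D V h T")
  case (Leaf b)
  have "\<phi> (Leaf b) \<le> ennreal (of_bool (b \<noteq> y))" by (rule \<phi>_Leaf)
  also have "\<dots> \<le> ennreal (c + B)" using c_nonneg B by (intro ennreal_leI) auto
  finally show ?thesis using Leaf by (simp add: resume_def)
next
  case (Query a T0 T1)
  then have "\<Phi> (resume R D V T h) \<le> ennreal c + ennreal B"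
    by (auto simp: resume_def \<Phi>_query intro!: add_left_mono R)
  then show ?thesis using c_nonneg B by simp
qed

text \<open>This crude bound by the number of rounds is what a run derailed by a search error is
  charged.\<close>

lemma \<Phi>_sim_le: "\<Phi> (sim n N d f D V T) \<le> ennreal ((4 * real N + 1) * c * real f + 1)"
proof (induction f arbitrary: D V T)
  case 0
  have "\<phi> (Leaf 0) \<le> ennreal (of_bool (0 \<noteq> y))" by (rule \<phi>_Leaf)
  also have "\<dots> \<le> ennreal 1" by (intro ennreal_leI) auto
  finally show ?case by simp
next
  case (Suc f)
  let ?B = "(4 * real N + 1) * c * real f + 1"
  have B: "1 \<le> ?B" using c_nonneg by simp
  have "\<Phi> (sim n N d (Suc f) D V T) \<le> ennreal ((c + ?B) + 4 * real N * c)"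
    unfolding sim.simps Let_def using c_nonneg B
    by (intro \<Phi>_search_le prefix_path_coords \<Phi>_resume_le Suc.IH) auto
  then show ?case by (simp add: algebra_simps)
qed

text \<open>The factor \<open>2 ^ f\<close> leaves enough rounds: every round doubles \<open>V\<close>, which embeds into
  the cube.\<close>

lemma \<Phi>_sim:
  assumes d: "n < 2 ^ d" "d \<le> N" and \<delta>: "(7/8) ^ N * 2 ^ d \<le> \<delta>"
  shows "answered n x D V \<Longrightarrow> partial_stars n x S D \<Longrightarrow> pdt_on n T \<Longrightarrow> pdt_eval n T x = y \<Longrightarrow>
    2 ^ n < card V * 2 ^ f \<Longrightarrow>
    \<Phi> (sim n N d f D V T)
      \<le> ennreal ((4 * real N + 1) * c * (1 + real (kept n x S V T))
          + real f * \<delta> * ((4 * real N + 1) * c * real f + 1))"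
proof (induction f arbitrary: D V T)
  case 0
  then show ?case using answered_finite_card(2)[of n x D V] by simp
next
  case (Suc f)
  note V = Suc.prems(1) and S = Suc.prems(2)
  define K where "K = (4 * real N + 1) * c"
  have K: "c \<le> K" "0 \<le> K" using c_nonneg by (auto simp: K_def algebra_simps)
  have \<delta>0: "0 \<le> \<delta>" using \<delta> by (rule order.trans[rotated]) simp
  let ?M = "c + (K * real f + 1)"
  have M: "0 \<le> K * real f + 1" using K by simp
  define k where "k = resume (sim n N d f) D V T"
  have k_le: "\<Phi> (k h) \<le> ennreal ?M" for h
    unfolding k_def K_def using c_nonneg by (intro \<Phi>_resume_le \<Phi>_sim_le) auto
  define h where "h = find (\<lambda>i. x i = 1) (path_coords n D V T)"
  let ?T = "stop_at D V h T"
  let ?e = "real f * \<delta> * (K * real f + 1)"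
  note stop = stop_at_find[OF V S, of T, folded h_def]
  have e: "0 \<le> ?e" using K \<delta>0 by simp
  \<comment> \<open>The constant is just \<open>c\<close>: together with the
    \<open>4 * N * c\<close> of the search below it makes one \<open>K\<close>, the charge for the
    final round.\<close>
  have found: "\<Phi> (k h) \<le> ennreal (c + K * real (kept n x S V T) + ?e)"
  proof (cases ?T)
    case (Leaf b)
    then have "\<Phi> (k h) = 0"
      using \<phi>_Leaf[of b] stop(1) Suc.prems(4) by (simp add: k_def resume_def)
    then show ?thesis by simp
  next
    case (Query a T0 T1)
    let ?D = "D \<union> set_option h" and ?b = "ip n a x"
    let ?T' = "if ?b = 0 then T0 else T1"
    have nsp: "\<not> spanned ?D V a" using stop(3)[OF Query] by simp
    have on: "a \<in> cube n" "pdt_on n ?T'"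
      using pdt_on_stop_at[OF Suc.prems(3), of D V h] Query by auto
    have hx: "i < n \<and> x i = 1" if "h = Some i" for i
      using that set_path_coords[of n D V T] unfolding h_def
      by (auto simp: find_Some_iff dest: nth_mem)
    have S': "partial_stars n x S ?D"
      using S hx unfolding partial_stars_def by (cases h) force+
    have V': "answered n x ?D V" using V by (rule answered_mono) auto
    have IH: "\<Phi> (sim n N d f ?D (extend V a ?b) ?T')
        \<le> ennreal (K * (1 + real (kept n x S (extend V a ?b) ?T')) + ?e)"
      unfolding K_def
    proof (rule Suc.IH[OF answered_extend[OF V' on(1) nsp] S' on(2)])
      show "pdt_eval n ?T' x = y" using stop(1) Suc.prems(4) Query by auto
      show "2 ^ n < card (extend V a ?b) * 2 ^ f"
        using Suc.prems(5) card_extend[OF V' nsp] by simp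
    qed
    \<comment> \<open>Hence the query asked in this round survives in the restricted tree and
      contributes the \<open>K\<close> that pays for the round.\<close>
    have "\<not> spanned S V a"
      using nsp spanned_antimono S' unfolding partial_stars_def by blast
    then have kept: "kept n x S V T = Suc (kept n x S (extend V a ?b) ?T')"
      using stop(2) Query by (cases ?b) auto
    have "\<Phi> (k h) = ennreal c + \<Phi> (sim n N d f ?D (extend V a ?b) ?T')"
      using Query by (cases ?b) (auto simp: k_def resume_def \<Phi>_query)
    also have "\<dots> \<le> ennreal c + ennreal (K * (1 + real (kept n x S (extend V a ?b) ?T')) + ?e)"
      by (intro add_left_mono IH)
    also have "\<dots> = ennreal (c + K * real (kept n x S V T) + ?e)"
    proof (subst ennreal_plus[symmetric])
      show "0 \<le> K * (1 + real (kept n x S (extend V a ?b) ?T')) + ?e"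
        by (rule add_nonneg_nonneg[OF mult_nonneg_nonneg[OF K(2)] e]) simp
    qed (use c_nonneg in \<open>simp_all add: kept distrib_left add.assoc\<close>)
    finally show ?thesis .
  qed
  have "\<Phi> (sim n N d (Suc f) D V T)
      \<le> \<Phi> (k h) + ennreal (4 * real N * c + ?M * ((7/8) ^ N * 2 ^ d))"
    using \<Phi>_search_find[of "dedup (path_coords n D V T)" d N k ?M] set_path_coords[of n D V T]
      d k_le M c_nonneg
    by (simp add: k_def h_def Let_def)
  also have "\<dots> \<le> ennreal (c + K * real (kept n x S V T) + ?e)
      + ennreal (4 * real N * c + ?M * \<delta>)"
    using \<delta> M c_nonneg by (intro add_mono found ennreal_leI add_left_mono mult_left_mono) auto
  also have "\<dots> = ennreal (c + K * real (kept n x S V T) + ?e + (4 * real N * c + ?M * \<delta>))"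
    using c_nonneg K e M \<delta>0 by (intro ennreal_plus[symmetric]) auto
  also have "\<dots> \<le> ennreal (K * (1 + real (kept n x S V T)) + real (Suc f) * \<delta> * (K * real (Suc f) + 1))"
  proof (rule ennreal_leI)
    have "?M * \<delta> \<le> (K * real (Suc f) + 1) * \<delta>"
      using K \<delta>0 by (intro mult_right_mono) (auto simp: algebra_simps)
    moreover have "?e \<le> real f * \<delta> * (K * real (Suc f) + 1)"
      using K \<delta>0 by (intro mult_left_mono add_mono) auto
    ultimately have "?e + ?M * \<delta> \<le> real (Suc f) * \<delta> * (K * real (Suc f) + 1)"
      by (simp add: algebra_simps)
    then show "c + K * real (kept n x S V T) + ?e + (4 * real N * c + ?M * \<delta>)
      \<le> K * (1 + real (kept n x S V T)) + real (Suc f) * \<delta> * (K * real (Suc f) + 1)"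
      by (simp add: K_def algebra_simps)
  qed
  finally show ?case unfolding K_def .
qed

end

section \<open>Coupling the input with the random fixing\<close>

text \<open>Used in both directions of the coupling: marks before bits, and bits before
  coins.\<close>

lemma Pi_pmf_bind2:
  assumes A: "finite A"
  shows "Pi_pmf A d (\<lambda>i. do {a \<leftarrow> p i; b \<leftarrow> q i a; return_pmf (g a b)}) =
    do {f \<leftarrow> Pi_pmf A d1 p; h \<leftarrow> Pi_pmf A d2 (\<lambda>i. q i (f i));
        return_pmf (\<lambda>i. if i \<in> A then g (f i) (h i) else d)}"
  by (subst Pi_pmf_bind[where d' = d1, OF A], intro bind_pmf_cong refl,
      subst Pi_pmf_bind[where d' = d2, OF A], intro bind_pmf_cong refl)
    (simp add: A)

definition uniform_bit :: "mark \<Rightarrow> bit pmf" where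
  "uniform_bit s = (if s = Star then map_pmf of_bool (bernoulli_pmf (1/2)) else return_pmf 0)"

lemma map_of_bool_bernoulli_half: "map_pmf of_bool (bernoulli_pmf (1/2)) = pmf_of_set (UNIV :: bit set)"
proof -
  have "bij_betw (of_bool :: bool \<Rightarrow> bit) UNIV UNIV"
    by (rule bij_betwI[of _ _ _ "\<lambda>b. b = 1"]) auto
  then show ?thesis
    unfolding bernoulli_pmf_half_conv_pmf_of_set by (intro map_pmf_of_set_bij_betw) auto
qed

lemma uniform_fixed_conv_Pi: "uniform_fixed n \<rho> = Pi_pmf {..<n} 0 (\<lambda>i. uniform_bit (\<rho> i))"
proof -
  define B :: "nat \<Rightarrow> bit set" where "B i = (if \<rho> i = Star then UNIV else {0})" for i
  have B: "uniform_bit (\<rho> i) = pmf_of_set (B i)" for i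
    by (simp add: uniform_bit_def B_def map_of_bool_bernoulli_half pmf_of_set_singleton)
  have "Pi_pmf {..<n} 0 (\<lambda>i. uniform_bit (\<rho> i)) = pmf_of_set (PiE_dflt {..<n} 0 B)"
    unfolding B by (intro Pi_pmf_of_set) (auto simp: B_def UNIV_bit)
  also have "PiE_dflt {..<n} 0 B = {x \<in> cube n. \<forall>i<n. \<rho> i = Zero \<longrightarrow> x i = 0}"
  proof -
    have "x i \<in> B i \<longleftrightarrow> (\<rho> i = Zero \<longrightarrow> x i = 0)" for x i
      by (cases "\<rho> i") (simp_all add: B_def)
    then show ?thesis unfolding PiE_dflt_def cube_def by (simp add: set_eq_iff not_less) blast
  qed
  finally show ?thesis by (simp add: uniform_fixed_def)
qed

definition mark_of :: "bool \<Rightarrow> mark" where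
  "mark_of b = (if b then Star else Zero)"

text \<open>The star is revealed by the bit itself if that is 1, and otherwise by an independent coin
  whose bias is the conditional probability of a star given the bit 0.\<close>

lemma star_coupling:
  assumes "0 \<le> p" "p \<le> 1 / 2"
  shows "do {s \<leftarrow> map_pmf mark_of (bernoulli_pmf (2 * p)); b \<leftarrow> uniform_bit s; return_pmf (s, b)} =
    do {b \<leftarrow> map_pmf of_bool (bernoulli_pmf p); r \<leftarrow> bernoulli_pmf (p / (1 - p));
        return_pmf (mark_of (b = 1 \<or> r), b)}"
    (is "?L = ?R")
proof (rule pmf_eqI)
  fix t :: "mark \<times> bit"
  \<comment> \<open>A star and a 0 occur together with probability \<open>2 * p * (1/2) = p\<close>,
    and a 0 with probability \<open>1 - p\<close>; the quotient is at most 1 because of the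
    0-bias.\<close>
  define q where "q = p / (1 - p)"
  have q: "0 \<le> q" "q \<le> 1" using assms by (auto simp: q_def)
  have pq: "(1 - p) * q = p" using assms by (simp add: q_def)
  have "(1 - p) * (1 - q) = 1 - 2 * p"
    unfolding right_diff_distrib[of _ 1] pq by simp
  note q = q pq this
  obtain s b where t: "t = (s, b)" by fastforce
  show "pmf ?L t = pmf ?R t"
    unfolding t q_def[symmetric] using assms q
    by (cases s; cases b)
      (simp_all add: bind_map_pmf pmf_bind uniform_bit_def mark_of_def bind_return_pmf)
qed

lemma zero_biased_params:
  assumes "zero_biased n \<mu>"
  obtains p where "\<And>i. i < n \<Longrightarrow> 0 \<le> p i \<and> p i \<le> 1 / 2"
    and "\<mu> = Pi_pmf {..<n} 0 (\<lambda>i. map_pmf of_bool (bernoulli_pmf (p i)))"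
    and "\<And>i. i < n \<Longrightarrow> delta \<mu> i = 2 * p i"
proof -
  obtain p where p: "\<And>i. i < n \<Longrightarrow> 0 \<le> p i \<and> p i \<le> 1"
    and \<mu>: "\<mu> = Pi_pmf {..<n} 0 (\<lambda>i. map_pmf of_bool (bernoulli_pmf (p i)))"
    using assms by (auto simp: zero_biased_def product_distribution_def)
  have marg: "measure_pmf.prob \<mu> {x. x i = b} = (if b = 1 then p i else 1 - p i)"
    if "i < n" for i b
  proof -
    have "measure_pmf.prob \<mu> {x. x i = b} = measure_pmf.prob (map_pmf (\<lambda>x. x i) \<mu>) {b}"
      by (simp add: vimage_def)
    also have "map_pmf (\<lambda>x. x i) \<mu> = map_pmf of_bool (bernoulli_pmf (p i))"
      unfolding \<mu> by (subst Pi_pmf_component) (use that in auto)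
    also have "measure_pmf.prob \<dots> {b} = measure_pmf.prob (bernoulli_pmf (p i)) {b = 1}"
      by (cases b) (auto simp: vimage_def intro!: arg_cong[where f = "measure _"])
    finally show ?thesis using p[OF that] by (cases b) (auto simp: measure_pmf_single)
  qed
  have "p i \<le> 1 / 2" if "i < n" for i
  proof -
    have "measure_pmf.prob \<mu> {x. x i = 0} \<ge> 1 / 2" using assms that by (auto simp: zero_biased_def)
    then show ?thesis using marg[OF that, of 0] by simp
  qed
  then show thesis
    using p \<mu> marg[of _ 1] by (intro that[of p]) (auto simp: delta_def)
qed

definition coins :: "nat \<Rightarrow> (nat \<Rightarrow> real) \<Rightarrow> (nat \<Rightarrow> bool) pmf" where
  "coins n p = Pi_pmf {..<n} False (\<lambda>i. bernoulli_pmf (p i / (1 - p i)))"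

text \<open>\<open>star_coupling\<close> is applied in every coordinate. To this end the pair of
  fixing and input is packed into one function with values in pairs.\<close>

lemma fixing_coupling:
  fixes F :: "nat set \<Rightarrow> (nat \<Rightarrow> bit) \<Rightarrow> ennreal"
  assumes p: "\<And>i. i < n \<Longrightarrow> 0 \<le> p i \<and> p i \<le> 1 / 2"
    and \<mu>: "\<mu> = Pi_pmf {..<n} 0 (\<lambda>i. map_pmf of_bool (bernoulli_pmf (p i)))"
    and \<delta>: "\<And>i. i < n \<Longrightarrow> delta \<mu> i = 2 * p i"
  shows "(\<integral>\<^sup>+ \<rho>. \<integral>\<^sup>+ x. F {i. i < n \<and> \<rho> i = Star} x \<partial>uniform_fixed n \<rho> \<partial>random_fixing n \<mu>)
    = (\<integral>\<^sup>+ x. \<integral>\<^sup>+ r. F {i. i < n \<and> (x i = 1 \<or> r i)} x \<partial>coins n p \<partial>\<mu>)"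
proof -
  let ?A = "{..<n}" and ?d = "(Zero, 0::bit)"
  let ?G = "\<lambda>w. F {i. i < n \<and> fst (w i) = Star} (\<lambda>i. if i < n then snd (w i) else 0)"
  have off: "(\<lambda>i. if i < n then x i else 0) = x" if "x \<in> set_pmf (Pi_pmf ?A (0::bit) q)" for x q
    using that set_Pi_pmf_subset[of ?A 0 q] by fastforce
  have G: "?G (\<lambda>i. if i \<in> ?A then (m i, x i) else ?d) = F {i. i < n \<and> m i = Star} x"
    if "x \<in> set_pmf (Pi_pmf ?A (0::bit) q)" for m x q
  proof -
    have "{i. i < n \<and> fst (if i \<in> ?A then (m i, x i) else ?d) = Star} = {i. i < n \<and> m i = Star}"
      by (rule Collect_cong) auto
    moreover have "(\<lambda>i. if i < n then snd (if i \<in> ?A then (m i, x i) else ?d) else 0)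
        = (\<lambda>i. if i < n then x i else 0)"
      by (rule ext) simp
    ultimately show ?thesis using off[OF that] by presburger
  qed
  have \<rho>: "random_fixing n \<mu> = Pi_pmf ?A Zero (\<lambda>i. map_pmf mark_of (bernoulli_pmf (2 * p i)))"
    unfolding random_fixing_def mark_of_def by (intro Pi_pmf_cong) (auto simp: \<delta>)
  have "(\<integral>\<^sup>+ \<rho>. \<integral>\<^sup>+ x. F {i. i < n \<and> \<rho> i = Star} x \<partial>uniform_fixed n \<rho> \<partial>random_fixing n \<mu>)
    = (\<integral>\<^sup>+ \<rho>. \<integral>\<^sup>+ x. ?G (\<lambda>i. if i \<in> ?A then (\<rho> i, x i) else ?d) \<partial>uniform_fixed n \<rho> \<partial>random_fixing n \<mu>)"
    by (rule nn_integral_cong, rule nn_integral_cong_AE, rule AE_pmfI,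
        rule G[symmetric], simp only: uniform_fixed_conv_Pi)
  also have "\<dots> = (\<integral>\<^sup>+ w. ?G w \<partial>Pi_pmf ?A ?d (\<lambda>i. do {
      s \<leftarrow> map_pmf mark_of (bernoulli_pmf (2 * p i)); b \<leftarrow> uniform_bit s; return_pmf (s, b)}))"
    by (simp only: Pi_pmf_bind2[where ?d1.0 = Zero and ?d2.0 = 0, OF finite_lessThan]
        \<rho> uniform_fixed_conv_Pi nn_integral_bind_pmf nn_integral_return_pmf zero_le)
  also have "Pi_pmf ?A ?d (\<lambda>i. do {
      s \<leftarrow> map_pmf mark_of (bernoulli_pmf (2 * p i)); b \<leftarrow> uniform_bit s; return_pmf (s, b)}) =
    Pi_pmf ?A ?d (\<lambda>i. do {b \<leftarrow> map_pmf of_bool (bernoulli_pmf (p i));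
      r \<leftarrow> bernoulli_pmf (p i / (1 - p i)); return_pmf (mark_of (b = 1 \<or> r), b)})"
    using p by (intro Pi_pmf_cong refl star_coupling) auto
  also have "(\<integral>\<^sup>+ w. ?G w \<partial>\<dots>) = (\<integral>\<^sup>+ x. \<integral>\<^sup>+ r.
      ?G (\<lambda>i. if i \<in> ?A then (mark_of (x i = 1 \<or> r i), x i) else ?d) \<partial>coins n p \<partial>\<mu>)"
    by (simp only: Pi_pmf_bind2[where ?d1.0 = 0 and ?d2.0 = False and
          g = "\<lambda>b r. (mark_of (b = 1 \<or> r), b)", OF finite_lessThan]
        \<mu> coins_def nn_integral_bind_pmf nn_integral_return_pmf zero_le)
  also have "\<dots> = (\<integral>\<^sup>+ x. \<integral>\<^sup>+ r. F {i. i < n \<and> (x i = 1 \<or> r i)} x \<partial>coins n p \<partial>\<mu>)"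
  proof (rule nn_integral_cong_AE, rule AE_pmfI, rule nn_integral_cong)
    fix x r assume "x \<in> set_pmf \<mu>"
    then have "?G (\<lambda>i. if i \<in> ?A then (mark_of (x i = 1 \<or> r i), x i) else ?d)
        = F {i. i < n \<and> mark_of (x i = 1 \<or> r i) = Star} x"
      by (intro G) (simp only: \<mu>)
    also have "{i. i < n \<and> mark_of (x i = 1 \<or> r i) = Star} = {i. i < n \<and> (x i = 1 \<or> r i)}"
      by (auto simp: mark_of_def)
    finally show "?G (\<lambda>i. if i \<in> ?A then (mark_of (x i = 1 \<or> r i), x i) else ?d)
        = F {i. i < n \<and> (x i = 1 \<or> r i)} x" .
  qed
  finally show ?thesis .
qed

lemma nn_integral_pmf_commute:
  "(\<integral>\<^sup>+ a. \<integral>\<^sup>+ b. f a b \<partial>measure_pmf B \<partial>measure_pmf A)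
    = (\<integral>\<^sup>+ b. \<integral>\<^sup>+ a. f a b \<partial>measure_pmf A \<partial>measure_pmf B)"
proof -
  have "(\<integral>\<^sup>+ z. (case z of (a, b) \<Rightarrow> f a b) \<partial>pair_pmf A B) =
      (\<integral>\<^sup>+ z. (case z of (a, b) \<Rightarrow> f a b) \<partial>map_pmf (\<lambda>(x, y). (y, x)) (pair_pmf B A))"
    by (subst pair_commute_pmf) (rule refl)
  then show ?thesis by (simp add: nn_integral_pair_pmf' case_prod_unfold)
qed

section \<open>The compiled tree\<close>

lemma search_parameters:
  assumes "1 \<le> n" "0 < \<gamma>" "\<gamma> \<le> 1 / 2"
  obtains d N where "n < 2 ^ d" "d \<le> N" "(7/8) ^ N * 2 ^ d \<le> \<gamma> / (real n + 1)"
    and "real N \<le> 30 * log 2 (real n / \<gamma>)"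
proof -
  define L where "L = log 2 (real n / \<gamma>)"
  have n: "1 \<le> real n" using assms by simp
  have "2 \<le> real n / \<gamma>" using assms n by (simp add: field_simps)
  then have L: "1 \<le> L" using assms by (simp add: L_def le_log_iff)
  obtain d where d: "2 ^ d \<le> n" "n < 2 ^ (d + 1)" using ex_power_ivl1[of 2 n] assms(1) by blast
  have "real (2 ^ (d + 1)) \<le> real (2 * n)" using d(1) by (subst of_nat_le_iff) simp
  then have d2: "2 ^ (d + 1) \<le> 2 * real n" by simp
  \<comment> \<open>The exponent 4 suffices for
    \<open>2 * n * (n + 1) / \<gamma> \<le> (n / \<gamma>) ^ 4\<close>, by
    \<open>\<gamma> \<le> 1 / 2\<close>.\<close>
  define m where "m = nat \<lceil>4 * L\<rceil>"
  have m: "4 * L \<le> real m" "real m \<le> 5 * L" using L by (auto simp: m_def) linarith+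
  have "2 * real n * (real n + 1) / \<gamma> \<le> (real n / \<gamma>) ^ 4"
  proof -
    have a: "2 * (real n + 1) \<le> 4 * real n ^ 3"
    proof -
      have "real n \<le> real n ^ 3" using power_increasing[of 1 3 "real n"] n by simp
      moreover have "1 \<le> real n ^ 3" using n by (rule one_le_power)
      moreover have "2 * (t + 1) \<le> 4 * u" if "t \<le> u" "1 \<le> u" for t u :: real
      proof -
        have "2 * t \<le> 2 * u" "2 \<le> 2 * u" using that by auto
        then show ?thesis by simp
      qed
      ultimately show ?thesis by blast
    qed
    have b: "\<gamma> ^ 3 \<le> 1 / 8" using power_mono[of \<gamma> "1/2" 3] assms by (simp add: power_divide)
    have "2 * real n * (real n + 1) * \<gamma> ^ 3 \<le> 2 * real n * (real n + 1) * (1 / 8)"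
      using b n by (intro mult_left_mono) auto
    also have "\<dots> \<le> real n * real n ^ 3"
      using mult_left_mono[OF a, of "real n"] n by simp
    finally have "2 * real n * (real n + 1) * \<gamma> ^ 3 \<le> real n ^ 4" by (simp add: eval_nat_numeral)
    then have "2 * real n * (real n + 1) * \<gamma> ^ 3 / \<gamma> ^ 4 \<le> real n ^ 4 / \<gamma> ^ 4"
      by (intro divide_right_mono) auto
    moreover have "2 * real n * (real n + 1) * \<gamma> ^ 3 / \<gamma> ^ 4 = 2 * real n * (real n + 1) / \<gamma>"
      using assms by (simp add: eval_nat_numeral)
    ultimately show ?thesis by (simp add: power_divide)
  qed
  also have "(real n / \<gamma>) ^ 4 = 2 powr (4 * L)"
  proof -
    have "2 powr L = real n / \<gamma>" using assms n by (simp add: L_def)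
    moreover have "2 powr (L * 4) = (2 powr L) ^ 4" by (simp flip: powr_powr)
    ultimately show ?thesis by (simp add: mult.commute)
  qed
  also have "\<dots> \<le> 2 powr real m" using m by (intro powr_mono) auto
  also have "\<dots> = 2 ^ m" by (simp add: powr_realpow)
  finally have pw: "2 * real n * (real n + 1) / \<gamma> \<le> 2 ^ m" .
  have half: "(1/2) ^ m * 2 ^ (d + 1) \<le> \<gamma> / (real n + 1)"
  proof -
    have "2 ^ (d + 1) * (real n + 1) \<le> 2 * real n * (real n + 1)"
      using d2 by (intro mult_right_mono) auto
    also have "\<dots> \<le> \<gamma> * 2 ^ m" using pw assms by (simp add: field_simps)
    finally show ?thesis by (simp add: field_simps)
  qed
  have "d + 1 \<le> m"
  proof -
    have "\<gamma> / (real n + 1) \<le> 1" using assms by simp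
    then have "((1::real)/2) ^ m * 2 ^ (d + 1) \<le> 1" using half by linarith
    then have "(2::real) ^ (d + 1) \<le> 2 ^ m" by (simp add: power_one_over field_simps)
    then show ?thesis by (rule power_le_imp_le_exp[rotated]) simp
  qed
  show thesis
  \<comment> \<open>Six steps halve the potential, since \<open>(7/8) ^ 6 \<le> 1/2\<close>; and 30
    = 6 * 5 from \<open>m \<le> 5 * L\<close>.\<close>
  proof (rule that[of "d + 1" "6 * m"])
    show "n < 2 ^ (d + 1)" by (rule d)
    show "d + 1 \<le> 6 * m" using \<open>d + 1 \<le> m\<close> by simp
    have "((7::real)/8) ^ (6 * m) \<le> (1/2) ^ m"
      unfolding power_mult by (intro power_mono) (simp_all add: eval_nat_numeral)
    then show "(7/8) ^ (6 * m) * 2 ^ (d + 1) \<le> \<gamma> / (real n + 1)"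
      using half by (meson mult_right_mono order.trans zero_le_numeral zero_le_power)
    show "real (6 * m) \<le> 30 * log 2 (real n / \<gamma>)" using m by (simp flip: L_def)
  qed
qed

text \<open>The coins are drawn without knowledge of the input. A coin at a coordinate with value 1
  does no harm, as that coordinate is a star anyway.\<close>

definition compile :: "nat \<Rightarrow> nat \<Rightarrow> nat \<Rightarrow> (nat \<Rightarrow> real) \<Rightarrow> pdt \<Rightarrow> pdt pmf" where
  "compile n N d p T =
     do {r \<leftarrow> coins n p; sim n N d (Suc n) {i. i < n \<and> r i} {((\<lambda>_. 0), 0)} T}"

lemma partial_stars_coins:
  "partial_stars n x {i. i < n \<and> (x i = 1 \<or> r i)} {i. i < n \<and> r i}"
  by (auto simp: partial_stars_def)

text \<open>\<open>\<Phi>_sim\<close> with \<open>c = 0\<close>: the \<open>n + 1\<close> rounds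
  suffice because the initial span has one element, and their errors
  \<open>\<gamma> / (n + 1)\<close> add up to \<open>\<gamma>\<close>.\<close>

lemma sim_error:
  assumes "n < 2 ^ d" "d \<le> N" "(7/8) ^ N * 2 ^ d \<le> \<gamma> / (real n + 1)" "pdt_on n T" "0 \<le> \<gamma>"
  shows "(\<integral>\<^sup>+ T'. ennreal (of_bool (pdt_eval n T' x \<noteq> y))
        \<partial>sim n N d (Suc n) {i. i < n \<and> r i} {((\<lambda>_. 0), 0)} T)
    \<le> ennreal (of_bool (pdt_eval n T x \<noteq> y)) + ennreal \<gamma>"
proof -
  interpret path_cost_bounded n x 0 "\<lambda>T. ennreal (of_bool (pdt_eval n T x \<noteq> y))" y
    by standard auto
  let ?P = "sim n N d (Suc n) {i. i < n \<and> r i} {((\<lambda>_. 0), 0)} T"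
  show ?thesis
  proof (cases "pdt_eval n T x = y")
    case True
    have "\<Phi> ?P \<le> ennreal (real (Suc n) * (\<gamma> / (real n + 1)))"
      using \<Phi>_sim[OF assms(1-3) answered_init partial_stars_coins[of n x r] assms(4) True,
        where f = "Suc n"]
      by (simp del: sim.simps)
    also have "real (Suc n) * (\<gamma> / (real n + 1)) = \<gamma>" by (simp add: field_simps)
    finally show ?thesis using True by (simp add: \<Phi>_def del: sim.simps)
  next
    case False
    have "\<Phi> ?P \<le> ennreal 1" using \<Phi>_sim_le[of N d "Suc n"] by (simp del: sim.simps)
    then show ?thesis using False unfolding \<Phi>_def by (auto intro: order.trans)
  qed
qed

lemma sim_queries:
  assumes "n < 2 ^ d" "d \<le> N" "(7/8) ^ N * 2 ^ d \<le> \<gamma> / (real n + 1)" "pdt_on n T"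
    and \<gamma>: "0 \<le> \<gamma>" "\<gamma> < 1 / real n" "1 \<le> n"
  shows "(\<integral>\<^sup>+ T'. of_nat (num_queries n T' x)
        \<partial>sim n N d (Suc n) {i. i < n \<and> r i} {((\<lambda>_. 0), 0)} T)
    \<le> ennreal (5 * (4 * real N + 1)) *
       (of_nat (kept n x {i. i < n \<and> (x i = 1 \<or> r i)} {((\<lambda>_. 0), 0)} T) + 1)"
proof -
  interpret path_cost_bounded n x 1 "\<lambda>T. of_nat (num_queries n T x)" "pdt_eval n T x"
    by standard auto
  let ?k = "kept n x {i. i < n \<and> (x i = 1 \<or> r i)} {((\<lambda>_. 0), 0)} T"
  let ?K = "4 * real N + 1"
  have "\<gamma> * real n \<le> 1" using \<gamma> by (simp add: field_simps)
  moreover have "\<gamma> \<le> 1"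
    using \<gamma> order.strict_trans2[of \<gamma> "1 / real n" 1] by simp
  ultimately have g: "\<gamma> * (real n + 1) \<le> 2" "\<gamma> \<le> 1" by (auto simp: distrib_left)
  have "\<Phi> (sim n N d (Suc n) {i. i < n \<and> r i} {((\<lambda>_. 0), 0)} T)
    \<le> ennreal (?K * (1 + real ?k) + (real n + 1) * (\<gamma> / (real n + 1)) * (?K * (real n + 1) + 1))"
    using \<Phi>_sim[OF assms(1-3) answered_init partial_stars_coins[of n x r] assms(4) refl,
      where f = "Suc n"]
    by (simp add: add.commute del: sim.simps)
  also have "(real n + 1) * (\<gamma> / (real n + 1)) = \<gamma>" by (simp add: field_simps)
  also have "ennreal (?K * (1 + real ?k) + \<gamma> * (?K * (real n + 1) + 1))
      \<le> ennreal (5 * ?K * (real ?k + 1))"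
  proof (rule ennreal_leI)
    \<comment> \<open>The derailed runs cost at most \<open>2 * ?K + 1\<close> on average; this is
      where \<open>\<gamma> < 1 / n\<close> enters.\<close>
    have "?K * (\<gamma> * (real n + 1)) \<le> ?K * 2" using g by (intro mult_left_mono) auto
    then have "\<gamma> * (?K * (real n + 1) + 1) \<le> 4 * ?K" using g by (simp add: algebra_simps)
    moreover have "4 * ?K \<le> 4 * ?K * (real ?k + 1)" by (simp add: algebra_simps)
    ultimately have "?K * (1 + real ?k) + \<gamma> * (?K * (real n + 1) + 1)
        \<le> ?K * (1 + real ?k) + 4 * ?K * (real ?k + 1)"
      by linarith
    also have "\<dots> = 5 * ?K * (real ?k + 1)" by (simp add: algebra_simps)
    finally show "?K * (1 + real ?k) + \<gamma> * (?K * (real n + 1) + 1) \<le> 5 * ?K * (real ?k + 1)" .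
  qed
  also have "\<dots> = ennreal (5 * ?K) * ennreal (real ?k + 1)" by (simp add: ennreal_mult)
  also have "ennreal (real ?k + 1) = of_nat ?k + 1" by (simp add: ennreal_of_nat_eq_real_of_nat)
  finally show ?thesis by (simp only: \<Phi>_def)
qed

section \<open>Error and skew cost as iterated integrals\<close>

lemma ennreal_err:
  "ennreal (err n f P \<mu>) = (\<integral>\<^sup>+ T. \<integral>\<^sup>+ x. ennreal (of_bool (pdt_eval n T x \<noteq> f x)) \<partial>\<mu> \<partial>P)"
proof -
  have "ennreal (err n f P \<mu>) = emeasure (pair_pmf P \<mu>) {(T, x). pdt_eval n T x \<noteq> f x}"
    by (simp add: err_def measure_pmf.emeasure_eq_measure)
  also have "\<dots> = (\<integral>\<^sup>+ z. indicator {(T, x). pdt_eval n T x \<noteq> f x} z \<partial>pair_pmf P \<mu>)"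
    by simp
  also have "\<dots> = (\<integral>\<^sup>+ T. \<integral>\<^sup>+ x. ennreal (of_bool (pdt_eval n T x \<noteq> f x)) \<partial>\<mu> \<partial>P)"
    unfolding nn_integral_pair_pmf' by (intro nn_integral_cong) (simp add: indicator_def)
  finally show ?thesis .
qed

lemma skew_cost_conv_kept:
  assumes p: "\<And>i. i < n \<Longrightarrow> 0 \<le> p i \<and> p i \<le> 1 / 2"
    and \<mu>: "\<mu> = Pi_pmf {..<n} 0 (\<lambda>i. map_pmf of_bool (bernoulli_pmf (p i)))"
    and \<delta>: "\<And>i. i < n \<Longrightarrow> delta \<mu> i = 2 * p i"
  shows "skew_cost n P \<mu> = (\<integral>\<^sup>+ T. \<integral>\<^sup>+ x. \<integral>\<^sup>+ r.
    of_nat (kept n x {i. i < n \<and> (x i = 1 \<or> r i)} {((\<lambda>_. 0), 0)} T) \<partial>coins n p \<partial>\<mu> \<partial>P)"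
proof -
  have q: "num_queries n (restrict_pdt n \<rho> T) x = kept n x {i. i < n \<and> \<rho> i = Star} {((\<lambda>_. 0), 0)} T"
    if "x \<in> set_pmf (uniform_fixed n \<rho>)" for x \<rho> T
  proof (rule num_queries_restrict, intro allI impI)
    fix i assume "i < n" "\<rho> i \<noteq> Star"
    moreover have "x \<in> PiE_dflt {..<n} 0 (set_pmf \<circ> (\<lambda>i. uniform_bit (\<rho> i)))"
      using that by (simp add: uniform_fixed_conv_Pi set_Pi_pmf)
    ultimately have "x i \<in> set_pmf (uniform_bit (\<rho> i))" by (simp add: PiE_dflt_def)
    then show "x i = 0" using \<open>\<rho> i \<noteq> Star\<close> by (simp add: uniform_bit_def)
  qed
  have "skew_cost n P \<mu> = (\<integral>\<^sup>+ \<rho>. \<integral>\<^sup>+ T. \<integral>\<^sup>+ x.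
      of_nat (kept n x {i. i < n \<and> \<rho> i = Star} {((\<lambda>_. 0), 0)} T)
      \<partial>uniform_fixed n \<rho> \<partial>P \<partial>random_fixing n \<mu>)"
    unfolding skew_cost_def avg_queries_def
    by (simp add: nn_integral_pair_pmf')
      (intro nn_integral_cong nn_integral_cong_AE AE_pmfI, simp add: q)
  also have "\<dots> = (\<integral>\<^sup>+ T. \<integral>\<^sup>+ \<rho>. \<integral>\<^sup>+ x.
      of_nat (kept n x {i. i < n \<and> \<rho> i = Star} {((\<lambda>_. 0), 0)} T)
      \<partial>uniform_fixed n \<rho> \<partial>random_fixing n \<mu> \<partial>P)"
    by (rule nn_integral_pmf_commute)
  also have "\<dots> = (\<integral>\<^sup>+ T. \<integral>\<^sup>+ x. \<integral>\<^sup>+ r.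
    of_nat (kept n x {i. i < n \<and> (x i = 1 \<or> r i)} {((\<lambda>_. 0), 0)} T) \<partial>coins n p \<partial>\<mu> \<partial>P)"
    by (intro nn_integral_cong fixing_coupling p \<mu> \<delta>)
  finally show ?thesis .
qed

lemma compile_tree:
  assumes n: "1 \<le> n" and \<mu>: "zero_biased n \<mu>" and \<gamma>: "0 < \<gamma>" "\<gamma> < 1 / real n" "\<gamma> \<le> 1 / 2"
    and P: "rpdt_on n P"
  obtains P' where "rpdt_on n P'" "err n f P' \<mu> \<le> err n f P \<mu> + \<gamma>"
    and "avg_queries n P' \<mu> \<le> ennreal (605 * log 2 (real n / \<gamma>)) * (skew_cost n P \<mu> + 1)"
proof -
  obtain p where p: "\<And>i. i < n \<Longrightarrow> 0 \<le> p i \<and> p i \<le> 1 / 2"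
    "\<mu> = Pi_pmf {..<n} 0 (\<lambda>i. map_pmf of_bool (bernoulli_pmf (p i)))"
    "\<And>i. i < n \<Longrightarrow> delta \<mu> i = 2 * p i"
    using zero_biased_params[OF \<mu>] by blast
  obtain d N where N: "n < 2 ^ d" "d \<le> N" "(7/8) ^ N * 2 ^ d \<le> \<gamma> / (real n + 1)"
    "real N \<le> 30 * log 2 (real n / \<gamma>)"
    using search_parameters[OF n \<gamma>(1,3)] by blast
  let ?L = "log 2 (real n / \<gamma>)"
  let ?K = "5 * (4 * real N + 1)"
  have "2 \<le> real n / \<gamma>" using \<gamma> n by (simp add: field_simps)
  then have L: "1 \<le> ?L" using \<gamma> by (simp add: le_log_iff)
  let ?sim = "\<lambda>r T. sim n N d (Suc n) {i. i < n \<and> r i} {((\<lambda>_. 0), 0)} T"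
  define P' where "P' = bind_pmf P (compile n N d p)"
  have on: "pdt_on n T" if "T \<in> set_pmf P" for T using that P by (simp add: rpdt_on_def)
  show thesis
  proof (rule that[of P'])
    show "rpdt_on n P'"
      using rpdt_on_sim[OF on] unfolding P'_def compile_def rpdt_on_def set_bind_pmf by blast
    have "ennreal (err n f P' \<mu>) = (\<integral>\<^sup>+ T. \<integral>\<^sup>+ r. \<integral>\<^sup>+ x. \<integral>\<^sup>+ T'.
        ennreal (of_bool (pdt_eval n T' x \<noteq> f x)) \<partial>?sim r T \<partial>\<mu> \<partial>coins n p \<partial>P)"
      unfolding ennreal_err P'_def compile_def
      by (simp only: nn_integral_bind_pmf) (subst (3) nn_integral_pmf_commute, rule refl)
    also have "\<dots> \<le> (\<integral>\<^sup>+ T. \<integral>\<^sup>+ r. \<integral>\<^sup>+ x.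
        ennreal (of_bool (pdt_eval n T x \<noteq> f x)) + ennreal \<gamma> \<partial>\<mu> \<partial>coins n p \<partial>P)"
      using \<gamma> by (intro nn_integral_mono_AE AE_pmfI nn_integral_mono sim_error[OF N(1-3)] on) auto
    also have "\<dots> = ennreal (err n f P \<mu>) + ennreal \<gamma>"
      unfolding ennreal_err by (simp add: nn_integral_add)
    also have "\<dots> = ennreal (err n f P \<mu> + \<gamma>)"
      using \<gamma> by (intro ennreal_plus[symmetric]) (auto simp: err_def)
    finally show "err n f P' \<mu> \<le> err n f P \<mu> + \<gamma>"
      using \<gamma> by (subst (asm) ennreal_le_iff) (auto simp: err_def)
    have "avg_queries n P' \<mu> = (\<integral>\<^sup>+ T. \<integral>\<^sup>+ x. \<integral>\<^sup>+ r. \<integral>\<^sup>+ T'.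
        of_nat (num_queries n T' x) \<partial>?sim r T \<partial>coins n p \<partial>\<mu> \<partial>P)"
    proof -
      have "avg_queries n P' \<mu> = (\<integral>\<^sup>+ T. \<integral>\<^sup>+ T'. \<integral>\<^sup>+ x.
          of_nat (num_queries n T' x) \<partial>\<mu> \<partial>compile n N d p T \<partial>P)"
        by (simp add: avg_queries_def nn_integral_pair_pmf' P'_def)
      also have "\<dots> = (\<integral>\<^sup>+ T. \<integral>\<^sup>+ x. \<integral>\<^sup>+ T'.
          of_nat (num_queries n T' x) \<partial>compile n N d p T \<partial>\<mu> \<partial>P)"
        by (intro nn_integral_cong nn_integral_pmf_commute)
      finally show ?thesis by (simp add: compile_def)
    qed
    also have "\<dots> \<le> (\<integral>\<^sup>+ T. \<integral>\<^sup>+ x. \<integral>\<^sup>+ r. ennreal ?K *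
        (of_nat (kept n x {i. i < n \<and> (x i = 1 \<or> r i)} {((\<lambda>_. 0), 0)} T) + 1) \<partial>coins n p \<partial>\<mu> \<partial>P)"
      using \<gamma> n
      by (intro nn_integral_mono_AE AE_pmfI nn_integral_mono sim_queries[OF N(1-3)] on) auto
    also have "\<dots> = ennreal ?K * (skew_cost n P \<mu> + 1)"
    proof -
      have "skew_cost n P \<mu> = (\<integral>\<^sup>+ T. \<integral>\<^sup>+ x. \<integral>\<^sup>+ r.
          of_nat (kept n x {i. i < n \<and> (x i = 1 \<or> r i)} {((\<lambda>_. 0), 0)} T) \<partial>coins n p \<partial>\<mu> \<partial>P)"
        by (intro skew_cost_conv_kept p)
      then show ?thesis by (simp add: nn_integral_cmult nn_integral_add)
    qed
    also have "\<dots> \<le> ennreal (605 * ?L) * (skew_cost n P \<mu> + 1)"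
      \<comment> \<open>605 = 5 * (4 * 30 + 1), with the summand 1 absorbed by
        \<open>1 \<le> ?L\<close>.\<close>
      using N(4) L by (intro mult_right_mono ennreal_leI) auto
    finally show "avg_queries n P' \<mu> \<le> ennreal (605 * ?L) * (skew_cost n P \<mu> + 1)" .
  qed
qed

text \<open>The inequality is solved for \<open>s a\<close> before the infimum is taken; division
  and truncated subtraction also handle infinite values and an empty \<open>A\<close>.\<close>

lemma ennreal_le_mult_INF_add_1:
  fixes c :: real and D :: ennreal
  assumes c: "0 < c" and le: "\<And>a. a \<in> A \<Longrightarrow> D \<le> ennreal c * (s a + 1)"
  shows "D \<le> ennreal c * ((INF a\<in>A. s a) + 1)"
proof -
  have "D / ennreal c - 1 \<le> s a" if "a \<in> A" for a
  proof -
    have "D / ennreal c \<le> s a + 1"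
      using le[OF that] c by (intro divide_le_posI_ennreal) auto
    then show ?thesis by (simp add: ennreal_minus_le_iff add.commute)
  qed
  then have "D / ennreal c - 1 \<le> (INF a\<in>A. s a)" by (intro INF_greatest)
  then have "D / ennreal c \<le> (INF a\<in>A. s a) + 1"
    by (simp add: ennreal_minus_le_iff add.commute)
  then have "ennreal c * (D / ennreal c) \<le> ennreal c * ((INF a\<in>A. s a) + 1)"
    by (intro mult_left_mono) auto
  moreover have "ennreal c * (D / ennreal c) = D"
    using c by (metis ennreal_eq_0_iff ennreal_neq_top ennreal_times_divide mult.commute mult_divide_eq_ennreal not_less)
  ultimately show ?thesis by simp
qed

text \<open>One of the two constant trees errs with probability at most 1/2, and it asks
  nothing.\<close>

lemma avg_complexity_half:
  assumes "1 / 2 \<le> \<epsilon>"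
  shows "avg_complexity n \<epsilon> f \<mu> = 0"
proof -
  have e: "err n f (return_pmf (Leaf b)) \<mu> = measure_pmf.prob \<mu> {x. b \<noteq> f x}" for b
    by (simp add: err_def pair_return_pmf1 vimage_def)
  have "{x. 0 \<noteq> f x} = - {x. 1 \<noteq> f x}" by (auto; metis bit_not_zero_iff)
  then have "measure_pmf.prob \<mu> {x. 0 \<noteq> f x} = 1 - measure_pmf.prob \<mu> {x. 1 \<noteq> f x}"
    using measure_pmf.prob_compl[of "{x. 1 \<noteq> f x}" \<mu>] by (simp add: Compl_eq_Diff_UNIV)
  then have "err n f (return_pmf (Leaf 0)) \<mu> \<le> 1 / 2 \<or> err n f (return_pmf (Leaf 1)) \<mu> \<le> 1 / 2"
    unfolding e by linarith
  then obtain b where "err n f (return_pmf (Leaf b)) \<mu> \<le> \<epsilon>"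
    using assms by (meson order.trans)
  then have "avg_complexity n \<epsilon> f \<mu> \<le> avg_queries n (return_pmf (Leaf b)) \<mu>"
    unfolding avg_complexity_def by (intro INF_lower) (auto simp: rpdt_on_def)
  then show ?thesis by (simp add: avg_queries_def nn_integral_pair_pmf')
qed

theorem theorem18:
  "\<exists>C::real. C > 0 \<and>
     (\<forall>(n::nat) (f :: (nat \<Rightarrow> bit) \<Rightarrow> bit) (\<mu> :: (nat \<Rightarrow> bit) pmf) (\<gamma>::real) (\<epsilon>::real).
        1 \<le> n \<longrightarrow> zero_biased n \<mu> \<longrightarrow> 0 < \<gamma> \<longrightarrow> \<gamma> < 1 / real n \<longrightarrow> 0 \<le> \<epsilon> \<longrightarrow>
        avg_complexity n (\<epsilon> + \<gamma>) f \<mu>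
          \<le> ennreal (C * log 2 (real n / \<gamma>)) * (skew_measure n \<epsilon> f \<mu> + 1))"
proof (intro exI[of _ 605] conjI allI impI)
  fix n :: nat and f :: "(nat \<Rightarrow> bit) \<Rightarrow> bit" and \<mu> :: "(nat \<Rightarrow> bit) pmf" and \<gamma> \<epsilon> :: real
  assume n: "1 \<le> n" and \<mu>: "zero_biased n \<mu>" and \<gamma>: "0 < \<gamma>" "\<gamma> < 1 / real n" and \<epsilon>: "0 \<le> \<epsilon>"
  let ?c = "605 * log 2 (real n / \<gamma>)"
  show "avg_complexity n (\<epsilon> + \<gamma>) f \<mu> \<le> ennreal ?c * (skew_measure n \<epsilon> f \<mu> + 1)"
  proof (cases "\<gamma> \<le> 1 / 2")
    case False
    \<comment> \<open>Here \<open>n = 1\<close>, and the logarithm can be arbitrarily close to 0.\<close>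
    then show ?thesis using \<epsilon> by (simp add: avg_complexity_half)
  next
    case True
    have "\<gamma> < real n" using True n by linarith
    then have "0 < ?c" using \<gamma> by (simp add: zero_less_log_cancel_iff)
    then show ?thesis unfolding skew_measure_def
    proof (rule ennreal_le_mult_INF_add_1)
      fix P assume "P \<in> {P. rpdt_on n P \<and> err n f P \<mu> \<le> \<epsilon>}"
      then have P: "rpdt_on n P" "err n f P \<mu> \<le> \<epsilon>" by auto
      obtain P' where P': "rpdt_on n P'" "err n f P' \<mu> \<le> err n f P \<mu> + \<gamma>"
        "avg_queries n P' \<mu> \<le> ennreal ?c * (skew_cost n P \<mu> + 1)"
        using compile_tree[OF n \<mu> \<gamma> True P(1)] by blast
      have "avg_complexity n (\<epsilon> + \<gamma>) f \<mu> \<le> avg_queries n P' \<mu>"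
        unfolding avg_complexity_def using P P' by (intro INF_lower) auto
      then show "avg_complexity n (\<epsilon> + \<gamma>) f \<mu> \<le> ennreal ?c * (skew_cost n P \<mu> + 1)"
        using P'(3) by simp
    qed
  qed
qed simp

end
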